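(* Consider the learning dynamics described in the context. For any true state $\mathbf{s}\in\mathcal{S}$ and any initial belief $\theta^0\in\Delta(\mathcal{S})$ with $\theta^0(s)>0$ for all $s\in\mathcal{S}$, there exist a random probability vector $\bar\theta\in\Delta(\mathcal{S})$ and a random edge load vector $\bar w$ such that, with probability 1 (when costs are generated by the true state $\mathbf{s}$), $$\lim_{k\to\infty}\theta^k=\bar\theta,\qquad \lim_{k\to\infty}w^{k*}=\bar w,$$ where $\bar\theta$ satisfies $$\bar\theta(s)=0\quad\text{for all } s\in\mathcal{S}^{\dagger}(\bar w),$$ and $\bar w$ is the (unique) Wardrop equilibrium edge load vector corresponding to the belief $\bar\theta$.
   Context: Network and states. A finite directed graph with a single origin-destination pair has edge set $\mathcal{E}$ and nonempty set $\mathcal{R}$ of routes (simple directed paths from origin to destination). $\mathcal{S}$ is a finite set of states and $\Delta(\mathcal{S})$ is the set of probability vectors on $\mathcal{S}$. For each $e\in\mathcal{E}$, $s\in\mathcal{S}$ there is an edge cost function $\ell_e^s:[0,\infty)\to\mathbb{R}$, continuous and strictly increasing, differentiable on $(0,\infty)$, and there is a constant $\alpha>0$ with $\frac{d\ell_e^s(w_e)}{dw_e}\ge\alpha$ for all $e\in\mathcal{E}$, $s\in\mathcal{S}$, $w_e>0$. Strategies and equilibrium. The total demand of nonatomic travelers is $D>0$. The feasible strategy set is $Q=\{q=(q_r)_{r\in\mathcal{R}}: q_r\ge 0,\ \sum_{r\in\mathcal{R}}q_r=D\}$. A strategy $q\in Q$ induces the edge load vector $w=(w_e)_{e\in\mathcal{E}}$,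 $w_e=\sum_{r\ni e}q_r$. The cost of route $r$ in state $s$ is $\ell_r^s(q)=\sum_{e\in r}\ell_e^s(w_e)$, and its expected cost under belief $\theta\in\Delta(\mathcal{S})$ is $\mathbb{E}_\theta[\ell_r^s(q)]=\sum_{s\in\mathcal{S}}\theta(s)\ell_r^s(q)$. A strategy $q^*\in Q$ is a Wardrop equilibrium corresponding to $\theta$ if for all $r\in\mathcal{R}$: $q_r^*>0\Rightarrow \mathbb{E}_\theta[\ell_r^s(q^* )]=\min_{r'\in\mathcal{R}}\mathbb{E}_\theta[\ell_{r'}^s(q^* )]$. For each $\theta$, all Wardrop equilibria induce the same edge load vector, called the equilibrium edge load vector corresponding to $\theta$. Learning dynamics. The true state $\mathbf{s}\in\mathcal{S}$ is fixed. The noise vectors $\epsilon^k=(\epsilon_e^k)_{e\in\mathcal{E}}$, $k=1,2,\dots$, are i.i.d. Gaussian with mean $0$ and nondegenerate covariance matrix $\Sigma$. Starting from the initial belief $\theta^0$, in each stage $k=1,2,\dots$: (i) $w^{k*}$ is the equilibrium edge load vector corresponding to the belief $\theta^{k-1}$; (ii) with $\mathcal{E}^k=\{e\in\mathcal{E}: w_e^{k*}>0\}$, the costs $c^k=(c_e^k)_{e\in\mathcal{E}^k}$, $c_e^k=\ell_e^{\mathbf{s}}(w_e^{k*})+\epsilon_e^k$, are observed; (iii) the belief is updated by Bayes' rule $$\theta^k(s)=\frac{\theta^{k-1}(s)\,\phi^k[s,w^{k*}](c^k)}{\sum_{s'\in\mathcal{S}}\theta^{k-1}(s')\,\phi^k[s',w^{k*}](c^k)},\quad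 s\in\mathcal{S},$$ where $\phi^k[s,w^{k*}]$ is the density of the Gaussian distribution with mean $(\ell_e^s(w_e^{k*}))_{e\in\mathcal{E}^k}$ and covariance matrix $\Sigma^k$, the submatrix of $\Sigma$ with rows and columns in $\mathcal{E}^k$. Distinguishable states. For an edge load vector $w$, $\mathcal{S}^\dagger(w)$ is the set of states $s\in\mathcal{S}$ for which there exists $e\in\mathcal{E}$ with $w_e>0$ and $\ell_e^s(w_e)\ne\ell_e^{\mathbf{s}}(w_e)$. *)

theory Defs
  imports "HOL-Probability.Probability" "HOL-Combinatorics.Permutations" "Graph_Theory.Digraph" "Graph_Theory.Arc_Walk"
begin

section \<open>Matrices and Gaussian densities over a finite index set\<close>

text \<open>
  The set of observed edges changes from stage to stage, so square matrices are functions
  \<open>'i \<Rightarrow> 'i \<Rightarrow> real\<close> together with an explicit finite index set \<open>I\<close>. Entries outside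
  \<open>I \<times> I\<close> are ignored, so the principal submatrix with rows and columns in \<open>J \<subseteq> I\<close> is
  the same function read over \<open>J\<close>.
\<close>

definition det_on :: "'i set \<Rightarrow> ('i \<Rightarrow> 'i \<Rightarrow> real) \<Rightarrow> real" where
  "det_on I A = (\<Sum>p | p permutes I. of_int (sign p) * (\<Prod>i\<in>I. A i (p i)))"

definition inverse_on :: "'i set \<Rightarrow> ('i \<Rightarrow> 'i \<Rightarrow> real) \<Rightarrow> ('i \<Rightarrow> 'i \<Rightarrow> real)" where
  "inverse_on I A =
     (SOME B. \<forall>i\<in>I. \<forall>j\<in>I. (\<Sum>k\<in>I. A i k * B k j) = (if i = j then 1 else 0) \<and>
                           (\<Sum>k\<in>I. B i k * A k j) = (if i = j then 1 else 0))"

lemma det_on_UNIV: "det_on UNIV (\<lambda>i j. A $ i $ j) = det (A :: real ^ 'n ^ 'n)"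
  by (simp add: det_on_def det_def)

definition quad_form_on :: "'i set \<Rightarrow> ('i \<Rightarrow> 'i \<Rightarrow> real) \<Rightarrow> ('i \<Rightarrow> real) \<Rightarrow> real" where
  "quad_form_on I A x = (\<Sum>i\<in>I. \<Sum>j\<in>I. x i * A i j * x j)"

definition nondegenerate_covariance_on :: "'i set \<Rightarrow> ('i \<Rightarrow> 'i \<Rightarrow> real) \<Rightarrow> bool" where
  "nondegenerate_covariance_on I A \<longleftrightarrow>
     (\<forall>i\<in>I. \<forall>j\<in>I. A i j = A j i) \<and>
     (\<forall>x. (\<exists>i\<in>I. x i \<noteq> 0) \<longrightarrow> 0 < quad_form_on I A x)"

text \<open>
  The density, with respect to the Lebesgue measure \<open>\<Pi>\<^sub>M i\<in>I. lborel\<close>, of the Gaussian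
  distribution with mean \<open>\<mu>\<close> and covariance matrix \<open>A\<close> (both restricted to \<open>I\<close>).
\<close>

definition gaussian_density_on ::
    "'i set \<Rightarrow> ('i \<Rightarrow> real) \<Rightarrow> ('i \<Rightarrow> 'i \<Rightarrow> real) \<Rightarrow> ('i \<Rightarrow> real) \<Rightarrow> real" where
  "gaussian_density_on I \<mu> A x =
     exp (- (1 / 2) * quad_form_on I (inverse_on I A) (\<lambda>i. x i - \<mu> i)) /
     sqrt ((2 * pi) ^ card I * det_on I A)"

section \<open>Routing game\<close>

text \<open>
  A route is a list of arcs. Strategies and beliefs are functions of which only the values on the
  route set \<open>R\<close> and the state set \<open>S\<close> matter; edge loads are \<open>0\<close> off the arcs of the routes.
\<close>

definition prob_vectors :: "'s set \<Rightarrow> ('s \<Rightarrow> real) set" where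
  "prob_vectors S = {\<theta>. (\<forall>s\<in>S. 0 \<le> \<theta> s) \<and> (\<Sum>s\<in>S. \<theta> s) = 1}"

definition strategies :: "'e list set \<Rightarrow> real \<Rightarrow> ('e list \<Rightarrow> real) set" where
  "strategies R D = {q. (\<forall>r\<in>R. 0 \<le> q r) \<and> (\<Sum>r\<in>R. q r) = D}"

definition edge_load :: "'e list set \<Rightarrow> ('e list \<Rightarrow> real) \<Rightarrow> 'e \<Rightarrow> real" where
  "edge_load R q e = (\<Sum>r | r \<in> R \<and> e \<in> set r. q r)"

definition route_cost ::
    "'e list set \<Rightarrow> ('e \<Rightarrow> 's \<Rightarrow> real \<Rightarrow> real) \<Rightarrow> ('e list \<Rightarrow> real) \<Rightarrow> 's \<Rightarrow> 'e list \<Rightarrow> real" where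
  "route_cost R \<l> q s r = (\<Sum>e\<in>set r. \<l> e s (edge_load R q e))"

definition expected_route_cost ::
    "'s set \<Rightarrow> 'e list set \<Rightarrow> ('e \<Rightarrow> 's \<Rightarrow> real \<Rightarrow> real) \<Rightarrow> ('s \<Rightarrow> real) \<Rightarrow>
     ('e list \<Rightarrow> real) \<Rightarrow> 'e list \<Rightarrow> real" where
  "expected_route_cost S R \<l> \<theta> q r = (\<Sum>s\<in>S. \<theta> s * route_cost R \<l> q s r)"

definition wardrop_equilibrium ::
    "'s set \<Rightarrow> 'e list set \<Rightarrow> real \<Rightarrow> ('e \<Rightarrow> 's \<Rightarrow> real \<Rightarrow> real) \<Rightarrow> ('s \<Rightarrow> real) \<Rightarrow>
     ('e list \<Rightarrow> real) \<Rightarrow> bool" where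
  "wardrop_equilibrium S R D \<l> \<theta> q \<longleftrightarrow>
     q \<in> strategies R D \<and>
     (\<forall>r\<in>R. q r > 0 \<longrightarrow>
        expected_route_cost S R \<l> \<theta> q r =
        Min ((\<lambda>r'. expected_route_cost S R \<l> \<theta> q r') ` R))"

definition is_equilibrium_load ::
    "'s set \<Rightarrow> 'e list set \<Rightarrow> real \<Rightarrow> ('e \<Rightarrow> 's \<Rightarrow> real \<Rightarrow> real) \<Rightarrow> ('s \<Rightarrow> real) \<Rightarrow>
     ('e \<Rightarrow> real) \<Rightarrow> bool" where
  "is_equilibrium_load S R D \<l> \<theta> w \<longleftrightarrow>
     (\<exists>q. wardrop_equilibrium S R D \<l> \<theta> q \<and> w = edge_load R q)"

definition equilibrium_load ::
    "'s set \<Rightarrow> 'e list set \<Rightarrow> real \<Rightarrow> ('e \<Rightarrow> 's \<Rightarrow> real \<Rightarrow> real) \<Rightarrow> ('s \<Rightarrow> real) \<Rightarrow> 'e \<Rightarrow> real" where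
  "equilibrium_load S R D \<l> \<theta> = (THE w. is_equilibrium_load S R D \<l> \<theta> w)"

definition distinguishable_states ::
    "'e set \<Rightarrow> 's set \<Rightarrow> ('e \<Rightarrow> 's \<Rightarrow> real \<Rightarrow> real) \<Rightarrow> 's \<Rightarrow> ('e \<Rightarrow> real) \<Rightarrow> 's set" where
  "distinguishable_states E S \<l> s\<^sub>0 w =
     {s\<in>S. \<exists>e\<in>E. w e > 0 \<and> \<l> e s (w e) \<noteq> \<l> e s\<^sub>0 (w e)}"

section \<open>Learning dynamics\<close>

definition used_edges :: "'e set \<Rightarrow> ('e \<Rightarrow> real) \<Rightarrow> 'e set" where
  "used_edges E w = {e\<in>E. w e > 0}"

definition likelihood ::
    "'e set \<Rightarrow> ('e \<Rightarrow> 's \<Rightarrow> real \<Rightarrow> real) \<Rightarrow> ('e \<Rightarrow> 'e \<Rightarrow> real) \<Rightarrow> ('e \<Rightarrow> real) \<Rightarrow>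
     ('e \<Rightarrow> real) \<Rightarrow> 's \<Rightarrow> real" where
  "likelihood E \<l> Cov w c s = gaussian_density_on (used_edges E w) (\<lambda>e. \<l> e s (w e)) Cov c"

definition bayes_update :: "'s set \<Rightarrow> ('s \<Rightarrow> real) \<Rightarrow> ('s \<Rightarrow> real) \<Rightarrow> 's \<Rightarrow> real" where
  "bayes_update S lik \<theta> s = \<theta> s * lik s / (\<Sum>s'\<in>S. \<theta> s' * lik s')"

text \<open>
  The belief after stage \<open>k\<close> as a function of the realised noise path \<open>\<eta>\<close>; \<open>\<eta> k e\<close> is the noise
  on edge \<open>e\<close> in stage \<open>k \<ge> 1\<close>, and \<open>\<eta> 0\<close> is not used. The costs \<open>c\<close> are relevant only on the
  edges with positive load, since \<open>likelihood\<close> ignores the other components.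
\<close>

primrec belief ::
    "'e set \<Rightarrow> 's set \<Rightarrow> 'e list set \<Rightarrow> real \<Rightarrow> ('e \<Rightarrow> 's \<Rightarrow> real \<Rightarrow> real) \<Rightarrow>
     ('e \<Rightarrow> 'e \<Rightarrow> real) \<Rightarrow> 's \<Rightarrow> ('s \<Rightarrow> real) \<Rightarrow> (nat \<Rightarrow> 'e \<Rightarrow> real) \<Rightarrow> nat \<Rightarrow> 's \<Rightarrow> real" where
  "belief E S R D \<l> Cov s\<^sub>0 \<theta>\<^sub>0 \<eta> 0 = \<theta>\<^sub>0"
| "belief E S R D \<l> Cov s\<^sub>0 \<theta>\<^sub>0 \<eta> (Suc k) =
     (let \<theta> = belief E S R D \<l> Cov s\<^sub>0 \<theta>\<^sub>0 \<eta> k;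
          w = equilibrium_load S R D \<l> \<theta>;
          c = (\<lambda>e. \<l> e s\<^sub>0 (w e) + \<eta> (Suc k) e)
      in bayes_update S (likelihood E \<l> Cov w c) \<theta>)"

text \<open>The load in stage \<open>k \<ge> 1\<close>; the value at \<open>k = 0\<close> is not part of the dynamics.\<close>

definition stage_load ::
    "'e set \<Rightarrow> 's set \<Rightarrow> 'e list set \<Rightarrow> real \<Rightarrow> ('e \<Rightarrow> 's \<Rightarrow> real \<Rightarrow> real) \<Rightarrow>
     ('e \<Rightarrow> 'e \<Rightarrow> real) \<Rightarrow> 's \<Rightarrow> ('s \<Rightarrow> real) \<Rightarrow> (nat \<Rightarrow> 'e \<Rightarrow> real) \<Rightarrow> nat \<Rightarrow> 'e \<Rightarrow> real" where
  "stage_load E S R D \<l> Cov s\<^sub>0 \<theta>\<^sub>0 \<eta> k =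
     equilibrium_load S R D \<l> (belief E S R D \<l> Cov s\<^sub>0 \<theta>\<^sub>0 \<eta> (k - 1))"

end

theory Submission
  imports Defs "Jordan_Normal_Form.Determinant"
begin

text \<open>
  The posterior odds of a state \<open>s\<close> against the true state form a nonnegative martingale under the
  true law, so they converge almost surely, and with them the beliefs. Equilibrium loads depend
  continuously on the belief, because expected edge costs are strongly monotone with modulus
  \<open>\<alpha>\<close>; hence the loads converge to the equilibrium of the limit belief. Conditionally on the past,
  the square root of the odds shrinks in expectation by the factor \<open>exp (- I / 8)\<close>, where \<open>I\<close> is the
  squared cost gap on the used edges in the norm of the inverse covariance. These losses telescope,
  so \<open>sqrt odds * (1 - exp (- I / 8))\<close> tends to \<open>0\<close> almost surely. If \<open>s\<close> keeps positive limit
  probability then \<open>I\<close> tends to \<open>0\<close>, and the costs of \<open>s\<close> and of the true state agree on every edge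
  used in the limit.
\<close>

section \<open>Gaussian densities\<close>

text \<open>The set of observed edges depends on the belief and may differ from stage to stage, so
  likelihoods live in spaces of varying dimension. Two devices remove this dependence. The cost gap
  on the used edges is encoded by a vector on all edges (\<open>tilt\<close>), which makes every
  likelihood ratio an exponential in the full noise vector; one exponential moment formula over all
  edges then serves every stage, without marginals of the noise law. And the squared gap on a used
  edge \<open>e\<close> is at most \<open>C e e * I\<close>, with a factor independent of the used
  set, so that vanishing \<open>I\<close> can be read off edge by edge. The loads move with the
  belief, so the observations are not identically distributed and a law of large numbers is not at
  hand. The square root replaces it: the power \<open>t\<close> of the ratio has conditional
  expectation \<open>exp (- t * (1 - t) * I / 2)\<close>; \<open>t = 1\<close> loses nothing, and
  \<open>t = 1 / 2\<close> loses most, which is the origin of the 8.\<close>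

text \<open>Conjugation by \<open>f\<close> carries the permutations of \<open>I\<close> to those of
  \<open>J\<close> and preserves signs. Determinants over arbitrary index sets are thereby moved to
  \<open>{0..<n}\<close>, where matrix theory applies.\<close>

lemma det_on_reindex:
  assumes f: "bij_betw f I J" and "finite I"
  shows "det_on J A = det_on I (\<lambda>i j. A (f i) (f j))"
proof -
  let ?h = "map_permutation I f"
  have g: "bij_betw (inv_into I f) J I" by (rule bij_betw_inv_into[OF f])
  have inj: "inj_on f I" using f by (rule bij_betw_imp_inj_on)
  have img: "f ` I = J" using f by (rule bij_betw_imp_surj_on)
  have "bij_betw ?h {p. p permutes I} {p. p permutes J}"
  proof (rule bij_betw_byWitness[where f' = "map_permutation J (inv_into I f)"])
    show "\<forall>p\<in>{p. p permutes I}. map_permutation J (inv_into I f) (?h p) = p"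
      using map_permutation_compose_inv[OF f] inj by auto
    show "\<forall>p\<in>{p. p permutes J}. ?h (map_permutation J (inv_into I f) p) = p"
      using map_permutation_compose_inv[OF g] img by (auto simp: f_inv_into_f)
    show "?h ` {p. p permutes I} \<subseteq> {p. p permutes J}"
      using map_permutation_permutes[OF f] by auto
    show "map_permutation J (inv_into I f) ` {p. p permutes J} \<subseteq> {p. p permutes I}"
      using map_permutation_permutes[OF g] by auto
  qed
  then have "det_on J A =
      (\<Sum>p | p permutes I. of_int (sign (?h p)) * (\<Prod>j\<in>J. A j (?h p j)))"
    unfolding det_on_def
    by (subst sum.reindex_bij_betw[of ?h "{p. p permutes I}" "{p. p permutes J}", symmetric]) auto
  also have "\<dots> = (\<Sum>p | p permutes I. of_int (sign p) * (\<Prod>i\<in>I. A (f i) (f (p i))))"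
  proof (rule sum.cong[OF refl])
    fix p assume "p \<in> {p. p permutes I}"
    then have p: "p permutes I" by simp
    have "(\<Prod>j\<in>J. A j (?h p j)) = (\<Prod>i\<in>I. A (f i) (?h p (f i)))"
      by (subst prod.reindex_bij_betw[OF f, symmetric]) simp
    also have "\<dots> = (\<Prod>i\<in>I. A (f i) (f (p i)))"
      using inj by (intro prod.cong) (auto simp: map_permutation_apply)
    finally show "of_int (sign (?h p)) * (\<Prod>j\<in>J. A j (?h p j)) =
        of_int (sign p) * (\<Prod>i\<in>I. A (f i) (f (p i)))"
      by (simp add: sign_map_permutation[OF inj p \<open>finite I\<close>])
  qed
  finally show ?thesis by (simp add: det_on_def)
qed

lemma det_on_eq_det:
  "det_on {0..<n} A = Determinant.det (Matrix.mat n n (\<lambda>(i, j). A i j))"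
proof -
  have "(\<Prod>i = 0..<n. Matrix.mat n n (\<lambda>(i, j). A i j) $$ (i, p i)) = (\<Prod>i = 0..<n. A i (p i))"
    if "p permutes {0..<n}" for p
    using permutes_in_image[OF that] by (intro prod.cong) auto
  then show ?thesis
    by (auto simp: det_on_def Determinant.det_def intro!: sum.cong)
qed

lemma quad_form_on_pos:
  assumes "nondegenerate_covariance_on J A" "i \<in> J" "v i \<noteq> 0"
  shows "0 < quad_form_on J A v"
proof -
  have "(\<exists>i\<in>J. v i \<noteq> 0) \<longrightarrow> 0 < quad_form_on J A v"
    using assms(1) unfolding nondegenerate_covariance_on_def by (elim conjE allE[where x = v])
  with assms(2,3) show ?thesis by blast
qed

text \<open>Extending a vector by zero off \<open>J\<close> does not change the value of the form.
  Hence the covariance of any set of observed edges is nondegenerate.\<close>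

lemma nondegenerate_covariance_on_subset:
  assumes "nondegenerate_covariance_on I A" "J \<subseteq> I" "finite I"
  shows "nondegenerate_covariance_on J A"
  unfolding nondegenerate_covariance_on_def
proof (intro conjI allI impI)
  show "\<forall>i\<in>J. \<forall>j\<in>J. A i j = A j i"
    using assms unfolding nondegenerate_covariance_on_def by blast
  fix x :: "'a \<Rightarrow> real" assume "\<exists>i\<in>J. x i \<noteq> 0"
  then obtain i where "i \<in> J" "x i \<noteq> 0" by blast
  then have "0 < quad_form_on I A (\<lambda>i. if i \<in> J then x i else 0)"
    using assms(2) by (intro quad_form_on_pos[OF assms(1), of i]) auto
  also have "quad_form_on I A (\<lambda>i. if i \<in> J then x i else 0) =
      (\<Sum>i\<in>I. if i \<in> J then (\<Sum>j\<in>I. if j \<in> J then x i * A i j * x j else 0) else 0)"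
    unfolding quad_form_on_def by (intro sum.cong refl) (auto intro!: sum.cong)
  also have "\<dots> = quad_form_on J A x"
    using assms(2,3) by (simp add: quad_form_on_def sum.If_cases Int_absorb1)
  finally show "0 < quad_form_on J A x" .
qed

lemma nondegenerate_covariance_on_reindex:
  assumes "nondegenerate_covariance_on J A" and f: "bij_betw f I J"
  shows "nondegenerate_covariance_on I (\<lambda>i j. A (f i) (f j))"
  unfolding nondegenerate_covariance_on_def
proof (intro conjI allI impI)
  show "\<forall>i\<in>I. \<forall>j\<in>I. A (f i) (f j) = A (f j) (f i)"
    using assms by (auto simp: nondegenerate_covariance_on_def dest: bij_betwE)
  fix x :: "'b \<Rightarrow> real" assume "\<exists>i\<in>I. x i \<noteq> 0"
  then obtain i where "i \<in> I" "x i \<noteq> 0" by blast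
  then have "0 < quad_form_on J A (\<lambda>j. x (inv_into I f j))"
    using bij_betwE[OF f] bij_betw_inv_into_left[OF f]
    by (intro quad_form_on_pos[OF assms(1), of "f i"]) auto
  also have "\<dots> = quad_form_on I (\<lambda>i j. A (f i) (f j)) x"
    using bij_betw_inv_into_left[OF f]
    by (simp add: quad_form_on_def sum.reindex_bij_betw[OF f, symmetric])
  finally show "0 < quad_form_on I (\<lambda>i j. A (f i) (f j)) x" .
qed

text \<open>A nonzero kernel vector would give the quadratic form the value 0.\<close>

lemma det_mat_nonzero:
  assumes "nondegenerate_covariance_on {0..<n} A"
  shows "Determinant.det (Matrix.mat n n (\<lambda>(i, j). A i j)) \<noteq> 0"
proof
  let ?A = "Matrix.mat n n (\<lambda>(i, j). A i j)"
  assume "Determinant.det ?A = 0"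
  then obtain v where v: "v \<in> carrier_vec n" "v \<noteq> 0\<^sub>v n" "?A *\<^sub>v v = 0\<^sub>v n"
    using det_0_iff_vec_prod_zero_field[of ?A n] by auto
  have "(\<Sum>j = 0..<n. A i j * vec_index v j) = 0" if "i < n" for i
  proof -
    have "vec_index (?A *\<^sub>v v) i = 0" using v(3) that by simp
    with that v(1) show ?thesis
      by (simp add: scalar_prod_def)
  qed
  then have "quad_form_on {0..<n} A (vec_index v) = 0"
    by (simp add: quad_form_on_def mult.assoc sum_distrib_left[symmetric])
  moreover obtain i where "i < n" "vec_index v i \<noteq> 0"
    using v(1,2) by (metis carrier_vecD eq_vecI index_zero_vec(1,2))
  then have "0 < quad_form_on {0..<n} A (vec_index v)"
    by (intro quad_form_on_pos[OF assms, of i]) auto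
  ultimately show False by simp
qed

lemma det_on_nonzero:
  assumes "nondegenerate_covariance_on J A" "finite J"
  shows "det_on J A \<noteq> 0"
proof -
  obtain f where f: "bij_betw f {0..<card J} J"
    using ex_bij_betw_nat_finite[OF assms(2)] by blast
  show ?thesis
    using det_mat_nonzero[OF nondegenerate_covariance_on_reindex[OF assms(1) f]]
    by (simp add: det_on_reindex[OF f] det_on_eq_det)
qed

text \<open>The \<open>SOME\<close> in \<open>inverse_on\<close> meets its specification only if a
  two-sided inverse exists. One comes from the nonzero determinant of the matrix over a numbering of
  \<open>J\<close>, and is pulled back along the numbering.\<close>

lemma inverse_on_inverse:
  assumes "nondegenerate_covariance_on J A" "finite J" and ij: "i \<in> J" "j \<in> J"
  shows "(\<Sum>k\<in>J. A i k * inverse_on J A k j) = (if i = j then 1 else 0)"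
    and "(\<Sum>k\<in>J. inverse_on J A i k * A k j) = (if i = j then 1 else 0)"
proof -
  define n where "n = card J"
  obtain f where f: "bij_betw f {0..<n} J"
    using ex_bij_betw_nat_finite[OF assms(2)] unfolding n_def by blast
  define g where "g = inv_into {0..<n} f"
  have g: "g x < n" "f (g x) = x" if "x \<in> J" for x
    using that f bij_betw_inv_into[OF f] bij_betw_inv_into_right[OF f]
    unfolding g_def by (auto dest!: bij_betwE)
  have gf: "g (f k) = k" if "k < n" for k
    using bij_betw_inv_into_left[OF f] that by (simp add: g_def)
  let ?A = "Matrix.mat n n (\<lambda>(i, j). A (f i) (f j))"
  have "Determinant.det ?A \<noteq> 0"
    using det_mat_nonzero[OF nondegenerate_covariance_on_reindex[OF assms(1) f]] .
  then have "?A \<in> Units (ring_mat TYPE(real) n ())"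
    by (intro det_non_zero_imp_unit) auto
  then obtain B where B: "B \<in> carrier_mat n n" "B * ?A = 1\<^sub>m n" "?A * B = 1\<^sub>m n"
    unfolding Units_def by (auto simp: ring_mat_simps)
  define C where "C x y = B $$ (g x, g y)" for x y
  have C: "(\<Sum>k\<in>J. A i k * C k j) = (if i = j then 1 else 0)"
       "(\<Sum>k\<in>J. C i k * A k j) = (if i = j then 1 else 0)" if ij: "i \<in> J" "j \<in> J" for i j
  proof -
    have eq: "g i = g j \<longleftrightarrow> i = j" using g ij by metis
    have "(?A * B) $$ (g i, g j) = (if i = j then 1 else 0)"
      using B(3) g(1) ij eq by simp
    moreover have "(?A * B) $$ (g i, g j) = (\<Sum>k = 0..<n. A i (f k) * C (f k) j)"
      using g ij B(1) by (auto simp: times_mat_def scalar_prod_def C_def gf intro!: sum.cong)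
    ultimately show "(\<Sum>k\<in>J. A i k * C k j) = (if i = j then 1 else 0)"
      by (simp add: sum.reindex_bij_betw[OF f, of "\<lambda>k. A i k * C k j", symmetric])
    have "(B * ?A) $$ (g i, g j) = (if i = j then 1 else 0)"
      using B(2) g(1) ij eq by simp
    moreover have "(B * ?A) $$ (g i, g j) = (\<Sum>k = 0..<n. C i (f k) * A (f k) j)"
      using g ij B(1) by (auto simp: times_mat_def scalar_prod_def C_def gf intro!: sum.cong)
    ultimately show "(\<Sum>k\<in>J. C i k * A k j) = (if i = j then 1 else 0)"
      by (simp add: sum.reindex_bij_betw[OF f, of "\<lambda>k. C i k * A k j", symmetric])
  qed
  then have ex: "\<exists>B. \<forall>i\<in>J. \<forall>j\<in>J. (\<Sum>k\<in>J. A i k * B k j) = (if i = j then 1 else 0) \<and>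
                           (\<Sum>k\<in>J. B i k * A k j) = (if i = j then 1 else 0)"
    by blast
  from someI_ex[OF ex]
  have inv: "\<forall>i\<in>J. \<forall>j\<in>J. (\<Sum>k\<in>J. A i k * inverse_on J A k j) = (if i = j then 1 else 0) \<and>
                 (\<Sum>k\<in>J. inverse_on J A i k * A k j) = (if i = j then 1 else 0)"
    unfolding inverse_on_def .
  show "(\<Sum>k\<in>J. A i k * inverse_on J A k j) = (if i = j then 1 else 0)"
       "(\<Sum>k\<in>J. inverse_on J A i k * A k j) = (if i = j then 1 else 0)"
    using inv ij by blast+
qed

lemma sum_mult_inverse_on:
  assumes "nondegenerate_covariance_on J A" "finite J" "i \<in> J"
  shows "(\<Sum>j\<in>J. A i j * (\<Sum>k\<in>J. inverse_on J A j k * d k)) = d i"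
    and "(\<Sum>j\<in>J. inverse_on J A i j * (\<Sum>k\<in>J. A j k * d k)) = d i"
proof -
  have "(\<Sum>j\<in>J. A i j * (\<Sum>k\<in>J. inverse_on J A j k * d k)) =
        (\<Sum>k\<in>J. (\<Sum>j\<in>J. A i j * inverse_on J A j k) * d k)"
    unfolding sum_distrib_left sum_distrib_right mult.assoc by (rule sum.swap)
  also have "\<dots> = (\<Sum>k\<in>J. if i = k then d k else 0)"
    using inverse_on_inverse(1)[OF assms(1,2,3)] by (intro sum.cong) auto
  finally show "(\<Sum>j\<in>J. A i j * (\<Sum>k\<in>J. inverse_on J A j k * d k)) = d i"
    using assms(2,3) by simp
  have "(\<Sum>j\<in>J. inverse_on J A i j * (\<Sum>k\<in>J. A j k * d k)) =
        (\<Sum>k\<in>J. (\<Sum>j\<in>J. inverse_on J A i j * A j k) * d k)"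
    unfolding sum_distrib_left sum_distrib_right mult.assoc by (rule sum.swap)
  also have "\<dots> = (\<Sum>k\<in>J. if i = k then d k else 0)"
    using inverse_on_inverse(2)[OF assms(1,2,3)] by (intro sum.cong) auto
  finally show "(\<Sum>j\<in>J. inverse_on J A i j * (\<Sum>k\<in>J. A j k * d k)) = d i"
    using assms(2,3) by simp
qed

text \<open>Completing the square: only \<open>A\<close> is known to be symmetric here, so the two cross terms are
  computed separately, each by cancelling \<open>A\<close> against its inverse.\<close>
lemma quad_form_on_inverse_on_shift:
  assumes A: "nondegenerate_covariance_on J A" and J: "finite J"
  shows "quad_form_on J (inverse_on J A) (\<lambda>i. x i - (\<Sum>j\<in>J. A i j * v j)) =
         quad_form_on J (inverse_on J A) x - 2 * (\<Sum>i\<in>J. v i * x i) + quad_form_on J A v"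
proof -
  define B where "B = inverse_on J A"
  define d where "d i = (\<Sum>j\<in>J. A i j * v j)" for i
  have q: "quad_form_on J B y = (\<Sum>i\<in>J. y i * (\<Sum>j\<in>J. B i j * y j))" for y
    by (simp add: quad_form_on_def sum_distrib_left mult.assoc)
  have Bd: "(\<Sum>j\<in>J. B i j * d j) = v i" if "i \<in> J" for i
    using sum_mult_inverse_on(2)[OF A J that, of v] by (simp add: B_def d_def)
  have dB: "(\<Sum>i\<in>J. d i * (\<Sum>j\<in>J. B i j * x j)) = (\<Sum>i\<in>J. v i * x i)"
  proof -
    have "(\<Sum>i\<in>J. d i * (\<Sum>j\<in>J. B i j * x j)) =
        (\<Sum>i\<in>J. \<Sum>k\<in>J. v k * (A k i * (\<Sum>j\<in>J. B i j * x j)))"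
      using A unfolding d_def sum_distrib_right nondegenerate_covariance_on_def
      by (intro sum.cong refl) (simp add: mult.commute mult.left_commute)
    also have "\<dots> = (\<Sum>k\<in>J. v k * (\<Sum>i\<in>J. A k i * (\<Sum>j\<in>J. B i j * x j)))"
      unfolding sum_distrib_left by (rule sum.swap)
    also have "\<dots> = (\<Sum>k\<in>J. v k * x k)"
      using sum_mult_inverse_on(1)[OF A J] by (simp add: B_def)
    finally show ?thesis .
  qed
  have "quad_form_on J B (\<lambda>i. x i - d i) =
      (\<Sum>i\<in>J. (x i - d i) * ((\<Sum>j\<in>J. B i j * x j) - v i))"
    unfolding q using Bd by (intro sum.cong refl) (simp add: right_diff_distrib sum_subtractf)
  also have "\<dots> = quad_form_on J B x - (\<Sum>i\<in>J. v i * x i)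
      - (\<Sum>i\<in>J. d i * (\<Sum>j\<in>J. B i j * x j)) + (\<Sum>i\<in>J. v i * d i)"
    unfolding q by (simp add: algebra_simps sum_subtractf sum.distrib)
  also have "(\<Sum>i\<in>J. v i * d i) = quad_form_on J A v"
    by (simp add: quad_form_on_def d_def sum_distrib_left mult.assoc)
  finally show ?thesis
    unfolding dB by (simp add: B_def d_def)
qed

text \<open>The determinant is known to be nonzero, which suffices: \<open>sqrt\<close> then has a
  nonzero value, and this common factor cancels in Bayes' rule.\<close>

lemma gaussian_density_on_nonzero:
  assumes "nondegenerate_covariance_on J A" "finite J"
  shows "gaussian_density_on J \<mu> A x \<noteq> 0"
  using det_on_nonzero[OF assms] by (simp add: gaussian_density_on_def)

text \<open>Completing the square with shift \<open>A v\<close> makes the quotient of the two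
  densities the exponential of an affine function of \<open>x\<close>. The form of the hypothesis
  covers both uses: a change of mean at a fixed point (likelihoods) and a translation of the point
  (exponential moments).\<close>

lemma gaussian_density_on_shift:
  assumes "nondegenerate_covariance_on J A" "finite J"
    and "\<And>i. i \<in> J \<Longrightarrow> y i - \<nu> i = x i - \<mu> i - (\<Sum>j\<in>J. A i j * v j)"
  shows "gaussian_density_on J \<nu> A y =
         gaussian_density_on J \<mu> A x * exp ((\<Sum>i\<in>J. v i * (x i - \<mu> i)) - quad_form_on J A v / 2)"
proof -
  have "quad_form_on J (inverse_on J A) (\<lambda>i. y i - \<nu> i) =
      quad_form_on J (inverse_on J A) (\<lambda>i. (x i - \<mu> i) - (\<Sum>j\<in>J. A i j * v j))"
    using assms(3) by (simp add: quad_form_on_def)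
  also have "\<dots> = quad_form_on J (inverse_on J A) (\<lambda>i. x i - \<mu> i)
      - 2 * (\<Sum>i\<in>J. v i * (x i - \<mu> i)) + quad_form_on J A v"
    by (rule quad_form_on_inverse_on_shift[OF assms(1,2)])
  finally have "- (1 / 2) * quad_form_on J (inverse_on J A) (\<lambda>i. y i - \<nu> i) =
      - (1 / 2) * quad_form_on J (inverse_on J A) (\<lambda>i. x i - \<mu> i)
      + ((\<Sum>i\<in>J. v i * (x i - \<mu> i)) - quad_form_on J A v / 2)"
    by linarith
  then show ?thesis
    unfolding gaussian_density_on_def by (simp only: exp_add times_divide_eq_left)
qed

lemma quad_form_on_nonneg:
  assumes "nondegenerate_covariance_on J A"
  shows "0 \<le> quad_form_on J A v"
proof (cases "\<exists>i\<in>J. v i \<noteq> 0")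
  case True
  then obtain i where "i \<in> J" "v i \<noteq> 0" by blast
  then show ?thesis by (intro less_imp_le quad_form_on_pos[OF assms, of i])
next
  case False
  then show ?thesis by (simp add: quad_form_on_def)
qed

text \<open>The Cauchy--Schwarz inequality for \<open>A\<close> applied to \<open>v\<close> and the \<open>i\<close>-th unit vector.\<close>
lemma square_le_quad_form_on:
  assumes A: "nondegenerate_covariance_on J A" and J: "finite J" "i \<in> J"
  shows "(\<Sum>j\<in>J. A i j * v j)\<^sup>2 \<le> A i i * quad_form_on J A v"
proof -
  define d where "d = (\<Sum>j\<in>J. A i j * v j)"
  define u where "u k = (if k = i then 1 else (0::real))" for k
  have sym: "A j k = A k j" if "j \<in> J" "k \<in> J" for j k
    using A that unfolding nondegenerate_covariance_on_def by blast
  have u_left: "(\<Sum>k\<in>J. u k * h k) = h i" and u_right: "(\<Sum>k\<in>J. h k * u k) = h i" for h :: "'a \<Rightarrow> real"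
  proof -
    have "(\<Sum>k\<in>J. u k * h k) = (\<Sum>k\<in>J. if k = i then h k else 0)"
      and "(\<Sum>k\<in>J. h k * u k) = (\<Sum>k\<in>J. if k = i then h k else 0)"
      by (auto simp: u_def intro!: sum.cong)
    then show "(\<Sum>k\<in>J. u k * h k) = h i" "(\<Sum>k\<in>J. h k * u k) = h i"
      using J by auto
  qed
  have q: "quad_form_on J A y = (\<Sum>k\<in>J. y k * (\<Sum>j\<in>J. A k j * y j))" for y
    by (simp add: quad_form_on_def sum_distrib_left mult.assoc)
  have expand: "quad_form_on J A (\<lambda>k. v k + t * u k) = quad_form_on J A v + 2 * t * d + t\<^sup>2 * A i i" for t
  proof -
    have "(\<Sum>j\<in>J. A k j * (v j + t * u j)) = (\<Sum>j\<in>J. A k j * v j) + t * A k i" for k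
      using u_right[of "A k"] by (simp add: algebra_simps sum.distrib sum_distrib_left[symmetric])
    then have "quad_form_on J A (\<lambda>k. v k + t * u k) =
        (\<Sum>k\<in>J. v k * (\<Sum>j\<in>J. A k j * v j)) + t * (\<Sum>k\<in>J. A k i * v k)
        + t * (\<Sum>k\<in>J. u k * (\<Sum>j\<in>J. A k j * v j)) + t * t * (\<Sum>k\<in>J. u k * A k i)"
      unfolding q by (simp add: algebra_simps sum.distrib sum_distrib_left)
    also have "(\<Sum>k\<in>J. A k i * v k) = d"
      unfolding d_def using sym J by (intro sum.cong) auto
    finally show ?thesis
      by (simp add: u_left q d_def power2_eq_square)
  qed
  have "0 < quad_form_on J A u"
    by (rule quad_form_on_pos[OF A J(2)]) (simp add: u_def)
  then have pos: "0 < A i i"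
    unfolding q by (simp add: u_left u_right)
  \<comment> \<open>The value at \<open>t = - d / A i i\<close>, the minimiser of the quadratic in
    \<open>t\<close>.\<close>
  have "0 \<le> quad_form_on J A v + 2 * (- d / A i i) * d + (- d / A i i)\<^sup>2 * A i i"
    using quad_form_on_nonneg[OF A] unfolding expand[symmetric] by blast
  also have "\<dots> = quad_form_on J A v - d\<^sup>2 / A i i"
    using pos by (simp add: field_simps power2_eq_square)
  finally show ?thesis
    using pos by (simp add: d_def field_simps)
qed

section \<open>Translation invariance and exponential moments\<close>

text \<open>On boxes this factors into translation invariance of \<open>lborel\<close> in each
  coordinate, and boxes determine the product measure.\<close>

lemma distr_PiM_lborel_translate:
  fixes a :: "'i \<Rightarrow> real"
  assumes I: "finite I"
  shows "distr (\<Pi>\<^sub>M i\<in>I. lborel) (\<Pi>\<^sub>M i\<in>I. lborel) (\<lambda>x. \<lambda>i\<in>I. x i + a i) = (\<Pi>\<^sub>M i\<in>I. lborel)"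
proof -
  interpret product_sigma_finite "\<lambda>_ :: 'i. lborel :: real measure" by standard
  let ?T = "\<lambda>x :: 'i \<Rightarrow> real. \<lambda>i\<in>I. x i + a i"
  have T[measurable]: "?T \<in> measurable (\<Pi>\<^sub>M i\<in>I. lborel) (\<Pi>\<^sub>M i\<in>I. lborel)"
    by (intro measurable_restrict) simp
  show ?thesis
  proof (rule PiM_eqI[OF I])
    fix A assume A: "\<And>i. i \<in> I \<Longrightarrow> A i \<in> sets (lborel :: real measure)"
    have meas: "(\<lambda>x. x + a i) -` A i \<in> sets borel" if "i \<in> I" for i
      using A[OF that] measurable_sets_borel[of "\<lambda>x. x + a i" borel "A i"] by simp
    have "?T -` Pi\<^sub>E I A \<inter> space (\<Pi>\<^sub>M i\<in>I. lborel) = Pi\<^sub>E I (\<lambda>i. (\<lambda>x. x + a i) -` A i)"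
      by (auto simp: space_PiM PiE_iff)
    then have "emeasure (distr (\<Pi>\<^sub>M i\<in>I. lborel) (\<Pi>\<^sub>M i\<in>I. lborel) ?T) (Pi\<^sub>E I A) =
        emeasure (\<Pi>\<^sub>M i\<in>I. lborel) (Pi\<^sub>E I (\<lambda>i. (\<lambda>x. x + a i) -` A i))"
      using I A by (subst emeasure_distr) (auto intro!: sets_PiM_I_finite)
    also have "\<dots> = (\<Prod>i\<in>I. emeasure lborel ((\<lambda>x. x + a i) -` A i))"
      using I meas by (intro emeasure_PiM) auto
    also have "\<dots> = (\<Prod>i\<in>I. emeasure lborel (A i))"
    proof (rule prod.cong[OF refl])
      fix i assume i: "i \<in> I"
      have "emeasure lborel (A i) = emeasure (distr lborel borel ((+) (a i))) (A i)"
        by (simp add: lborel_distr_plus)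
      also have "\<dots> = emeasure lborel ((\<lambda>x. x + a i) -` A i)"
        using A[OF i] by (subst emeasure_distr) (auto simp: add.commute[of _ "a i"])
      finally show "emeasure lborel ((\<lambda>x. x + a i) -` A i) = emeasure lborel (A i)" by simp
    qed
    finally show "emeasure (distr (\<Pi>\<^sub>M i\<in>I. lborel) (\<Pi>\<^sub>M i\<in>I. lborel) ?T) (Pi\<^sub>E I A) =
        (\<Prod>i\<in>I. emeasure lborel (A i))" .
  qed simp
qed

text \<open>No Gaussian integral is computed: the normalisation is a hypothesis, and exponential
  tilting is a translation.\<close>
lemma gaussian_density_on_mgf:
  assumes C: "nondegenerate_covariance_on I C" and I: "finite I"
    and meas[measurable]: "(\<lambda>x. ennreal (gaussian_density_on I (\<lambda>_. 0) C x)) \<in> borel_measurable (\<Pi>\<^sub>M i\<in>I. lborel)"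
    and one: "(\<integral>\<^sup>+x. ennreal (gaussian_density_on I (\<lambda>_. 0) C x) \<partial>(\<Pi>\<^sub>M i\<in>I. lborel)) = 1"
  shows "(\<integral>\<^sup>+x. ennreal (gaussian_density_on I (\<lambda>_. 0) C x) * ennreal (exp (\<Sum>i\<in>I. v i * x i))
      \<partial>(\<Pi>\<^sub>M i\<in>I. lborel)) = ennreal (exp (quad_form_on I C v / 2))"
proof -
  let ?P = "\<Pi>\<^sub>M i\<in>I. lborel :: real measure"
  let ?\<phi> = "gaussian_density_on I (\<lambda>_. 0) C"
  let ?T = "\<lambda>x. \<lambda>i\<in>I. x i + (- (\<Sum>j\<in>I. C i j * v j))"
  have T[measurable]: "?T \<in> measurable ?P ?P"
    by (intro measurable_restrict) simp
  \<comment> \<open>\<open>?T\<close> subtracts \<open>C v\<close>, the shift that absorbs the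
    linear exponent.\<close>
  have tilt: "?\<phi> x * exp (\<Sum>i\<in>I. v i * x i) = ?\<phi> (?T x) * exp (quad_form_on I C v / 2)" for x
  proof -
    have "?\<phi> (?T x) = ?\<phi> x * exp ((\<Sum>i\<in>I. v i * (x i - 0)) - quad_form_on I C v / 2)"
      by (rule gaussian_density_on_shift[OF C I]) simp
    then show ?thesis by (simp add: exp_diff)
  qed
  have "(\<integral>\<^sup>+x. ennreal (?\<phi> x) * ennreal (exp (\<Sum>i\<in>I. v i * x i)) \<partial>?P) =
      (\<integral>\<^sup>+x. ennreal (?\<phi> (?T x)) * ennreal (exp (quad_form_on I C v / 2)) \<partial>?P)"
    using tilt by (simp add: ennreal_mult''[symmetric])
  also have "\<dots> = (\<integral>\<^sup>+x. ennreal (?\<phi> (?T x)) \<partial>?P) * ennreal (exp (quad_form_on I C v / 2))"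
    by (intro nn_integral_multc measurable_compose[OF T meas])
  also have "(\<integral>\<^sup>+x. ennreal (?\<phi> (?T x)) \<partial>?P) = (\<integral>\<^sup>+x. ennreal (?\<phi> x) \<partial>distr ?P ?P ?T)"
    by (intro nn_integral_distr[OF T, symmetric]) simp
  also have "\<dots> = 1" by (simp only: distr_PiM_lborel_translate[OF I] one)
  finally show ?thesis by simp
qed

section \<open>Independence of the past\<close>

text \<open>\<open>indep_var\<close> requires both variables to have values of the same type, which rules it out
  for the pair of the identity, seen as a map into the history algebra, and the next variable.\<close>
lemma (in prob_space) nn_integral_indep_history:
  fixes X :: "'i \<Rightarrow> 'a \<Rightarrow> 'b" and J :: "'i set" and N :: "'b measure"
  defines "F \<equiv> vimage_algebra (space M) (\<lambda>\<omega>. \<lambda>j\<in>J. X j \<omega>) (\<Pi>\<^sub>M j\<in>J. N)"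
  assumes ind: "indep_vars (\<lambda>_. N) X I" and J: "J \<subseteq> I" and i: "i \<in> I" "i \<notin> J"
    and f[measurable]: "f \<in> borel_measurable (F \<Otimes>\<^sub>M N)"
  shows "(\<integral>\<^sup>+\<omega>. f (\<omega>, X i \<omega>) \<partial>M) = (\<integral>\<^sup>+\<omega>. (\<integral>\<^sup>+y. f (\<omega>, y) \<partial>distr M N (X i)) \<partial>M)"
proof -
  let ?H = "\<lambda>\<omega>. \<lambda>j\<in>J. X j \<omega>" and ?Y = "\<lambda>\<omega>. \<lambda>j\<in>{i}. X j \<omega>"
  have X[measurable]: "X j \<in> measurable M N" if "j \<in> I" for j
    using ind that by (auto simp: indep_vars_def)
  have H[measurable]: "?H \<in> measurable M (\<Pi>\<^sub>M j\<in>J. N)"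
    using J by (intro measurable_restrict X) auto
  have H_space: "?H \<in> space M \<rightarrow> space (\<Pi>\<^sub>M j\<in>J. N)"
    using measurable_space[OF H] by (rule funcsetI)
  have id[measurable]: "(\<lambda>\<omega>. \<omega>) \<in> measurable M F"
    unfolding F_def by (rule measurable_vimage_algebra2) simp_all
  have Xi[measurable]: "X i \<in> measurable M N" using i by simp
  \<comment> \<open>Wrapping \<open>X i\<close> as a family over \<open>{i}\<close> gives both
    variables the same value type.\<close>
  have ind2: "indep_var (\<Pi>\<^sub>M j\<in>J. N) ?H (\<Pi>\<^sub>M j\<in>{i}. N) ?Y"
    using i J by (intro indep_var_restrict[OF ind]) auto
  interpret Y: prob_space "distr M N (X i)" by (rule prob_space_distr[OF Xi])
  interpret F: prob_space "distr M F (\<lambda>\<omega>. \<omega>)" by (rule prob_space_distr[OF id])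
  \<comment> \<open>Independence as a product law: every set of \<open>F\<close> is a preimage under
    the history map, so rectangles reduce to \<open>ind2\<close>.\<close>
  have law: "distr M F (\<lambda>\<omega>. \<omega>) \<Otimes>\<^sub>M distr M N (X i) = distr M (F \<Otimes>\<^sub>M N) (\<lambda>\<omega>. (\<omega>, X i \<omega>))"
  proof (rule pair_measure_eqI)
    show "sigma_finite_measure (distr M F (\<lambda>\<omega>. \<omega>))" "sigma_finite_measure (distr M N (X i))"
      by unfold_locales
    show "sets (distr M F (\<lambda>\<omega>. \<omega>) \<Otimes>\<^sub>M distr M N (X i)) = sets (distr M (F \<Otimes>\<^sub>M N) (\<lambda>\<omega>. (\<omega>, X i \<omega>)))"
      by (simp cong: sets_pair_measure_cong)
    fix A B assume "A \<in> sets (distr M F (\<lambda>\<omega>. \<omega>))" "B \<in> sets (distr M N (X i))"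
    then have A: "A \<in> sets F" and B: "B \<in> sets N" by auto
    obtain A' where A': "A' \<in> sets (\<Pi>\<^sub>M j\<in>J. N)" "A = ?H -` A' \<inter> space M"
      using A unfolding F_def sets_vimage_algebra2[OF H_space] by blast
    let ?B = "(\<lambda>x. x i) -` B \<inter> space (\<Pi>\<^sub>M j\<in>{i}. N)"
    have "(\<lambda>x. x i) \<in> measurable (\<Pi>\<^sub>M j\<in>{i}. N) N"
      by (rule measurable_component_singleton) simp
    from measurable_sets[OF this B] have B': "?B \<in> sets (\<Pi>\<^sub>M j\<in>{i}. N)" .
    have Y_vimage: "?Y -` ?B \<inter> space M = X i -` B \<inter> space M"
      using measurable_space[OF Xi] by (auto simp: space_PiM)
    have "prob ((\<lambda>\<omega>. (?H \<omega>, ?Y \<omega>)) -` (A' \<times> ?B) \<inter> space M) =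
        prob (?H -` A' \<inter> space M) * prob (?Y -` ?B \<inter> space M)"
      by (rule indep_varD[OF ind2 A'(1) B'])
    moreover have "(\<lambda>\<omega>. (?H \<omega>, ?Y \<omega>)) -` (A' \<times> ?B) \<inter> space M = (?H -` A' \<inter> space M) \<inter> (?Y -` ?B \<inter> space M)"
      by auto
    ultimately have "prob (A \<inter> (X i -` B \<inter> space M)) = prob A * prob (X i -` B \<inter> space M)"
      unfolding Y_vimage A'(2) by (simp only:)
    moreover have "(\<lambda>\<omega>. (\<omega>, X i \<omega>)) -` (A \<times> B) \<inter> space M = A \<inter> (X i -` B \<inter> space M)"
      using A'(2) by auto
    moreover have "A \<inter> space M = A" using A'(2) by auto
    ultimately show "emeasure (distr M F (\<lambda>\<omega>. \<omega>)) A * emeasure (distr M N (X i)) B =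
        emeasure (distr M (F \<Otimes>\<^sub>M N) (\<lambda>\<omega>. (\<omega>, X i \<omega>))) (A \<times> B)"
      using A B by (simp add: emeasure_distr emeasure_eq_measure ennreal_mult[symmetric])
  qed
  have f': "f \<in> borel_measurable (distr M F (\<lambda>\<omega>. \<omega>) \<Otimes>\<^sub>M distr M N (X i))"
    using f by (simp cong: measurable_cong_sets sets_pair_measure_cong)
  have "(\<integral>\<^sup>+\<omega>. f (\<omega>, X i \<omega>) \<partial>M) = (\<integral>\<^sup>+z. f z \<partial>distr M (F \<Otimes>\<^sub>M N) (\<lambda>\<omega>. (\<omega>, X i \<omega>)))"
    by (intro nn_integral_distr[symmetric]) (use f in simp_all)
  also have "\<dots> = (\<integral>\<^sup>+x. (\<integral>\<^sup>+y. f (x, y) \<partial>distr M N (X i)) \<partial>distr M F (\<lambda>\<omega>. \<omega>))"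
    unfolding law[symmetric] by (rule Y.nn_integral_fst[OF f', symmetric])
  also have "\<dots> = (\<integral>\<^sup>+\<omega>. (\<integral>\<^sup>+y. f (\<omega>, y) \<partial>distr M N (X i)) \<partial>M)"
    by (rule nn_integral_distr[OF id]) (use Y.borel_measurable_nn_integral_fst[OF f'] in simp)
  finally show ?thesis .
qed

section \<open>Convergence of nonnegative supermartingales\<close>

text \<open>Escape to infinity is excluded by \<open>below\<close>, oscillation by
  \<open>osc\<close>. Only rational levels occur, so that almost sure statements about single pairs
  can later be combined.\<close>

lemma convergent_if_no_oscillation:
  fixes x :: "nat \<Rightarrow> real"
  assumes nonneg: "\<And>n. 0 \<le> x n"
    and osc: "\<And>a b. a \<in> \<rat> \<Longrightarrow> b \<in> \<rat> \<Longrightarrow> a < b \<Longrightarrow>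
      \<not> ((\<exists>\<^sub>F n in sequentially. x n < a) \<and> (\<exists>\<^sub>F n in sequentially. b < x n))"
    and below: "\<exists>\<^sub>F n in sequentially. x n < c"
  shows "convergent x"
proof -
  obtain a where a: "a \<in> \<rat>" "c < a" using Rats_dense_in_real[of c "c + 1"] by auto
  have "\<exists>\<^sub>F n in sequentially. x n < a"
    using below by (rule frequently_elim1) (use a in linarith)
  \<comment> \<open>Crossing between \<open>a\<close> and \<open>a + 1\<close> infinitely often is
    excluded, so a bound met infinitely often becomes an eventual one.\<close>
  with osc[of a "a + 1"] a have "\<forall>\<^sub>F n in sequentially. x n \<le> a + 1"
    by (auto simp: not_frequently not_less)
  then obtain N where "\<And>n. N \<le> n \<Longrightarrow> x n \<le> a + 1"
    by (auto simp: eventually_sequentially)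
  then have "norm (x n) \<le> max (a + 1) (Max (x ` {..N}))" for n
    using nonneg[of n] by (cases "N \<le> n") (auto simp: le_max_iff_disj)
  then have "bounded (range x)" unfolding bounded_iff by blast
  then obtain l r where r: "strict_mono r" "(x \<circ> r) \<longlonglongrightarrow> l"
    using bounded_imp_convergent_subsequence by blast
  have near: "\<exists>\<^sub>F n in sequentially. \<bar>x n - l\<bar> < d" if dpos: "d > 0" for d
    unfolding frequently_sequentially
  proof
    fix N
    obtain K where K: "\<And>k. k \<ge> K \<Longrightarrow> \<bar>x (r k) - l\<bar> < d"
      using LIMSEQ_D[OF r(2) dpos] by auto
    moreover have "N \<le> r (max N K)" using seq_suble[OF r(1), of "max N K"] by simp
    ultimately show "\<exists>n\<ge>N. \<bar>x n - l\<bar> < d" by (intro exI[of _ "r (max N K)"]) auto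
  qed
  have "x \<longlonglongrightarrow> l"
  proof (rule tendstoI)
    fix d :: real assume d: "d > 0"
    \<comment> \<open>One rational pair on either side, between distances \<open>d / 2\<close> and
      \<open>d\<close> from \<open>l\<close>. The inner neighbourhood is visited infinitely often,
      so leaving the outer one infinitely often would cross a pair.\<close>
    obtain a1 where a1: "a1 \<in> \<rat>" "l - d < a1" "a1 < l - d / 2"
      using Rats_dense_in_real[of "l - d" "l - d / 2"] d by auto
    obtain a2 where a2: "a2 \<in> \<rat>" "a1 < a2" "a2 < l - d / 2"
      using Rats_dense_in_real[of a1 "l - d / 2"] a1 by auto
    obtain b1 where b1: "b1 \<in> \<rat>" "l + d / 2 < b1" "b1 < l + d"
      using Rats_dense_in_real[of "l + d / 2" "l + d"] d by auto
    obtain b2 where b2: "b2 \<in> \<rat>" "l + d / 2 < b2" "b2 < b1"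
      using Rats_dense_in_real[of "l + d / 2" b1] b1 by auto
    have nr: "\<exists>\<^sub>F n in sequentially. \<bar>x n - l\<bar> < d / 2" using near[of "d / 2"] d by simp
    have "\<exists>\<^sub>F n in sequentially. a2 < x n"
      using nr by (rule frequently_elim1) (use a2 in linarith)
    with osc[OF a1(1) a2(1,2)] have low: "\<forall>\<^sub>F n in sequentially. a1 \<le> x n"
      by (auto simp: not_frequently not_less)
    have "\<exists>\<^sub>F n in sequentially. x n < b2"
      using nr by (rule frequently_elim1) (use b2 in linarith)
    with osc[OF b2(1) b1(1) b2(3)] have up: "\<forall>\<^sub>F n in sequentially. x n \<le> b1"
      by (auto simp: not_frequently not_less)
    show "\<forall>\<^sub>F n in sequentially. dist (x n) l < d"
      using low up by eventually_elim (use a1 b1 in \<open>auto simp: dist_real_def abs_if\<close>)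
  qed
  then show ?thesis by (rule convergentI)
qed

text \<open>Doob's upcrossing strategy: \<open>upcrossing_hold a b x n\<close> tells whether an asset with price path
  \<open>x\<close> is held from time \<open>n\<close> to \<open>n + 1\<close> when it is bought below \<open>a\<close> and sold above \<open>b\<close>.\<close>
primrec upcrossing_hold :: "real \<Rightarrow> real \<Rightarrow> (nat \<Rightarrow> real) \<Rightarrow> nat \<Rightarrow> bool" where
  "upcrossing_hold a b x 0 = (x 0 < a)"
| "upcrossing_hold a b x (Suc n) = (x (Suc n) < a \<or> (upcrossing_hold a b x n \<and> x (Suc n) \<le> b))"

text \<open>The right-hand side is the trading gain. Each sale realises more than
  \<open>b - a\<close>; an open position is valued against \<open>a\<close>, an upper bound of its
  purchase price, so the estimate passes through the induction.\<close>

lemma upcrossing_gain: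
  assumes "a < b"
  shows "(\<Sum>k<n. (b - a) * of_bool (upcrossing_hold a b x k \<and> \<not> upcrossing_hold a b x (Suc k)))
      + (if upcrossing_hold a b x n then x n - a else 0)
    \<le> (\<Sum>k<n. of_bool (upcrossing_hold a b x k) * (x (Suc k) - x k))"
proof (induction n)
  case (Suc n)
  then show ?case using assms by (auto split: if_splits)
qed simp

text \<open>Below \<open>a\<close> the asset is always held, above \<open>b\<close> never; a sale
  must lie in between.\<close>

lemma upcrossing_hold_flips:
  assumes "a < b"
    and "\<exists>\<^sub>F n in sequentially. x n < a" "\<exists>\<^sub>F n in sequentially. b < x n"
  shows "\<exists>\<^sub>F n in sequentially. upcrossing_hold a b x n \<and> \<not> upcrossing_hold a b x (Suc n)"
  unfolding frequently_sequentially
proof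
  fix N
  have buy: "upcrossing_hold a b x n" if "x n < a" for n
    using that by (cases n) auto
  have sell: "\<not> upcrossing_hold a b x n" if "b < x n" for n
    using that assms(1) by (cases n) auto
  obtain n where n: "n \<ge> N" "x n < a" using assms(2) unfolding frequently_sequentially by blast
  obtain m where m: "m \<ge> n" "b < x m" using assms(3) unfolding frequently_sequentially by blast
  show "\<exists>k\<ge>N. upcrossing_hold a b x k \<and> \<not> upcrossing_hold a b x (Suc k)"
  proof (rule ccontr)
    assume neg: "\<not> ?thesis"
    have "upcrossing_hold a b x m"
      using m(1) by (induction m rule: dec_induct) (use buy[OF n(2)] neg n(1) in \<open>auto intro: order_trans\<close>)
    with sell[OF m(2)] show False by simp
  qed
qed

text \<open>The supermartingale property is stated by integrals over past events instead of
  conditional expectations: the odds provide it in this form, and the trading strategy uses it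
  so.\<close>

locale nonneg_supermartingale = prob_space +
  fixes F :: "nat \<Rightarrow> 'a measure" and X :: "nat \<Rightarrow> 'a \<Rightarrow> real"
  assumes subalg: "\<And>n. subalgebra M (F n)"
    and filtration: "\<And>n. sets (F n) \<subseteq> sets (F (Suc n))"
    and adapted: "\<And>n. X n \<in> borel_measurable (F n)"
    and nonneg: "\<And>n \<omega>. 0 \<le> X n \<omega>"
    and integrable: "\<And>n. integrable M (X n)"
    and supermartingale: "\<And>n A. A \<in> sets (F n) \<Longrightarrow>
      (\<integral>\<omega>. indicator A \<omega> * X (Suc n) \<omega> \<partial>M) \<le> (\<integral>\<omega>. indicator A \<omega> * X n \<omega> \<partial>M)"
begin

lemma space_F: "space (F n) = space M"
  using subalg by (simp add: subalgebra_def)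

lemma sets_F: "A \<in> sets (F n) \<Longrightarrow> A \<in> sets M"
  using subalg by (auto simp: subalgebra_def)

text \<open>Holding from \<open>n\<close> to \<open>n + 1\<close> is decided at time
  \<open>n\<close>, so the supermartingale inequality applies to that increment.\<close>

lemma upcrossing_hold_measurable:
  "{\<omega> \<in> space M. upcrossing_hold a b (\<lambda>k. X k \<omega>) n} \<in> sets (F n)"
proof (induction n)
  case 0
  have "{\<omega> \<in> space (F 0). X 0 \<omega> < a} \<in> sets (F 0)" using adapted[of 0] by measurable
  then show ?case by (simp add: space_F)
next
  case (Suc n)
  have "{\<omega> \<in> space (F (Suc n)). X (Suc n) \<omega> < a} \<union>
      ({\<omega> \<in> space M. upcrossing_hold a b (\<lambda>k. X k \<omega>) n} \<inter> {\<omega> \<in> space (F (Suc n)). X (Suc n) \<omega> \<le> b})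
      \<in> sets (F (Suc n))"
    using adapted[of "Suc n"] Suc filtration[of n] by (intro sets.Un sets.Int) auto
  moreover have "{\<omega> \<in> space M. upcrossing_hold a b (\<lambda>k. X k \<omega>) (Suc n)} =
      {\<omega> \<in> space (F (Suc n)). X (Suc n) \<omega> < a} \<union>
      ({\<omega> \<in> space M. upcrossing_hold a b (\<lambda>k. X k \<omega>) n} \<inter> {\<omega> \<in> space (F (Suc n)). X (Suc n) \<omega> \<le> b})"
    by (auto simp: space_F)
  ultimately show ?case by simp
qed

text \<open>Doob's upcrossing inequality: trading has nonpositive expected gain and the open
  position loses at most \<open>\<bar>a\<bar>\<close>, so the expected number of sales is at most
  \<open>\<bar>a\<bar> / (b - a)\<close>. Borel-Cantelli leaves finitely many sales.\<close>

lemma AE_finitely_many_upcrossings: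
  assumes "a < b"
  shows "AE \<omega> in M. \<not> ((\<exists>\<^sub>F n in sequentially. X n \<omega> < a) \<and> (\<exists>\<^sub>F n in sequentially. b < X n \<omega>))"
proof -
  let ?C = "\<lambda>n. {\<omega> \<in> space M. upcrossing_hold a b (\<lambda>k. X k \<omega>) n}"
  let ?U = "\<lambda>n. ?C n - ?C (Suc n)"
  have C[measurable]: "?C n \<in> sets M" for n using sets_F[OF upcrossing_hold_measurable] .
  have U: "?U n \<in> sets M" for n using C by blast
  have int_U: "integrable M (\<lambda>\<omega>. c * indicator (?U n) \<omega> :: real)" for c n
    using U by (intro integrable_mult_right integrable_real_indicator) (auto simp: emeasure_eq_measure)
  have int: "integrable M (\<lambda>\<omega>. indicator (?C k) \<omega> * X n \<omega>)" for k n
    using integrable_mult_indicator[OF C integrable, of k n] by simp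
  have bound: "(\<Sum>k<n. measure M (?U k)) \<le> \<bar>a\<bar> / (b - a)" for n
  proof -
    have "(\<Sum>k<n. (b - a) * measure M (?U k)) = (\<integral>\<omega>. (\<Sum>k<n. (b - a) * indicator (?U k) \<omega>) \<partial>M)"
      using U int_U by (subst Bochner_Integration.integral_sum) (auto simp del: upcrossing_hold.simps)
    also have "\<dots> \<le> (\<integral>\<omega>. (\<bar>a\<bar> + (\<Sum>k<n. indicator (?C k) \<omega> * X (Suc k) \<omega> - indicator (?C k) \<omega> * X k \<omega>)) \<partial>M)"
    proof (rule integral_mono)
      show "integrable M (\<lambda>\<omega>. \<Sum>k<n. (b - a) * indicator (?U k) \<omega>)"
        by (intro Bochner_Integration.integrable_sum int_U)
      show "integrable M (\<lambda>\<omega>. \<bar>a\<bar> + (\<Sum>k<n. indicator (?C k) \<omega> * X (Suc k) \<omega> - indicator (?C k) \<omega> * X k \<omega>))"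
        using int by (intro Bochner_Integration.integrable_add Bochner_Integration.integrable_sum Bochner_Integration.integrable_diff) auto
      fix \<omega> assume \<omega>: "\<omega> \<in> space M"
      let ?h = "upcrossing_hold a b (\<lambda>k. X k \<omega>)"
      have ind: "indicator (?C k) \<omega> = (of_bool (?h k) :: real)"
        "indicator (?U k) \<omega> = (of_bool (?h k \<and> \<not> ?h (Suc k)) :: real)" for k
        using \<omega> by (auto simp: indicator_def)
      have "- \<bar>a\<bar> \<le> (if ?h n then X n \<omega> - a else 0)" using nonneg[of n \<omega>] by auto
      with upcrossing_gain[OF assms, of "\<lambda>k. X k \<omega>" n]
      show "(\<Sum>k<n. (b - a) * indicator (?U k) \<omega>)
          \<le> \<bar>a\<bar> + (\<Sum>k<n. indicator (?C k) \<omega> * X (Suc k) \<omega> - indicator (?C k) \<omega> * X k \<omega>)"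
        unfolding ind right_diff_distrib by linarith
    qed
    also have "\<dots> = \<bar>a\<bar> + (\<Sum>k<n. (\<integral>\<omega>. indicator (?C k) \<omega> * X (Suc k) \<omega> \<partial>M) - (\<integral>\<omega>. indicator (?C k) \<omega> * X k \<omega> \<partial>M))"
      using int by (simp add: prob_space)
    also have "\<dots> \<le> \<bar>a\<bar>"
      using supermartingale[OF upcrossing_hold_measurable] by (simp add: sum_nonpos)
    finally show ?thesis
      unfolding sum_distrib_left[symmetric] using assms by (simp only: pos_le_divide_eq mult.commute diff_gt_0_iff_gt)
  qed
  have "summable (\<lambda>n. measure M (?U n))"
    by (rule summableI_nonneg_bounded[OF _ bound]) simp
  then have "AE \<omega> in M. eventually (\<lambda>n. \<omega> \<in> space M - ?U n) sequentially"
    using U by (intro borel_cantelli_AE1) (auto simp: emeasure_eq_measure)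
  then show ?thesis
  proof (rule AE_mp, intro AE_I2 impI notI)
    fix \<omega> assume \<omega>: "\<omega> \<in> space M" "\<forall>\<^sub>F n in sequentially. \<omega> \<in> space M - ?U n"
      and osc: "(\<exists>\<^sub>F n in sequentially. X n \<omega> < a) \<and> (\<exists>\<^sub>F n in sequentially. b < X n \<omega>)"
    have "\<exists>\<^sub>F n in sequentially. \<omega> \<in> ?U n"
      using upcrossing_hold_flips[OF assms, of "\<lambda>k. X k \<omega>"] osc \<omega>(1) by simp
    moreover have "\<forall>\<^sub>F n in sequentially. \<not> \<omega> \<in> ?U n"
      using \<omega>(2) by eventually_elim auto
    ultimately show False unfolding frequently_def by blast
  qed
qed

text \<open>Fatou's lemma: the means do not increase, so the lower limit has finite expectation and
  is finite almost surely. This excludes divergence to infinity.\<close>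

lemma AE_frequently_bounded: "AE \<omega> in M. \<exists>c. \<exists>\<^sub>F n in sequentially. X n \<omega> < c"
proof -
  have X[measurable]: "X n \<in> borel_measurable M" for n using integrable by auto
  have mean_le: "(\<integral>\<omega>. X n \<omega> \<partial>M) \<le> (\<integral>\<omega>. X 0 \<omega> \<partial>M)" for n
  proof (induction n)
    case (Suc n)
    have "(\<integral>\<omega>. X (Suc n) \<omega> \<partial>M) = (\<integral>\<omega>. indicator (space M) \<omega> * X (Suc n) \<omega> \<partial>M)"
      by (intro Bochner_Integration.integral_cong) auto
    also have "\<dots> \<le> (\<integral>\<omega>. indicator (space M) \<omega> * X n \<omega> \<partial>M)"
      using supermartingale[of "space M" n] sets.top[of "F n"] by (simp add: space_F)
    also have "\<dots> = (\<integral>\<omega>. X n \<omega> \<partial>M)"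
      by (intro Bochner_Integration.integral_cong) auto
    finally show ?case using Suc by simp
  qed simp
  have "(\<integral>\<^sup>+\<omega>. liminf (\<lambda>n. ennreal (X n \<omega>)) \<partial>M) \<le> liminf (\<lambda>n. \<integral>\<^sup>+\<omega>. ennreal (X n \<omega>) \<partial>M)"
    by (intro nn_integral_liminf) measurable
  also have "\<dots> \<le> limsup (\<lambda>n. \<integral>\<^sup>+\<omega>. ennreal (X n \<omega>) \<partial>M)"
    by (intro Liminf_le_Limsup) simp
  also have "\<dots> \<le> ennreal (\<integral>\<omega>. X 0 \<omega> \<partial>M)"
    using mean_le nonneg integrable by (intro Limsup_bounded always_eventually allI) (simp add: nn_integral_eq_integral ennreal_leI)
  finally have "(\<integral>\<^sup>+\<omega>. liminf (\<lambda>n. ennreal (X n \<omega>)) \<partial>M) \<noteq> \<infinity>"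
    by (auto simp: top_unique)
  then have "AE \<omega> in M. liminf (\<lambda>n. ennreal (X n \<omega>)) \<noteq> \<infinity>"
    by (intro nn_integral_noteq_infinite) measurable
  then show ?thesis
  proof (rule AE_mp, intro AE_I2 impI)
    fix \<omega> assume fin: "liminf (\<lambda>n. ennreal (X n \<omega>)) \<noteq> \<infinity>"
    show "\<exists>c. \<exists>\<^sub>F n in sequentially. X n \<omega> < c"
    proof (rule ccontr)
      assume "\<not> ?thesis"
      then have ev: "\<forall>\<^sub>F n in sequentially. c \<le> X n \<omega>" for c
        by (auto simp: not_frequently not_less)
      have "of_nat m \<le> liminf (\<lambda>n. ennreal (X n \<omega>))" for m
        by (intro Liminf_bounded eventually_mono[OF ev[of "real m"]])
          (metis ennreal_leI ennreal_of_nat_eq_real_of_nat)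
      then have "liminf (\<lambda>n. ennreal (X n \<omega>)) = \<infinity>"
        unfolding infinity_ennreal_def using ennreal_Ex_less_of_nat by (metis linorder_not_less top.not_eq_extremum)
      with fin show False by simp
    qed
  qed
qed

text \<open>Doob's convergence theorem; countably many rational pairs share one null set.\<close>

theorem AE_convergent: "AE \<omega> in M. convergent (\<lambda>n. X n \<omega>)"
proof -
  have "AE \<omega> in M. \<forall>p\<in>{(a, b). a \<in> \<rat> \<and> b \<in> \<rat> \<and> a < b}.
      \<not> ((\<exists>\<^sub>F n in sequentially. X n \<omega> < fst p) \<and> (\<exists>\<^sub>F n in sequentially. snd p < X n \<omega>))"
  proof (intro AE_ball_countable[THEN iffD2] ballI)
    show "countable {(a :: real, b). a \<in> \<rat> \<and> b \<in> \<rat> \<and> a < b}"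
      by (rule countable_subset[of _ "\<rat> \<times> \<rat>"]) (auto intro: countable_rat)
    fix p :: "real \<times> real" assume "p \<in> {(a, b). a \<in> \<rat> \<and> b \<in> \<rat> \<and> a < b}"
    then have "fst p < snd p" by auto
    then show "AE \<omega> in M. \<not> ((\<exists>\<^sub>F n in sequentially. X n \<omega> < fst p) \<and> (\<exists>\<^sub>F n in sequentially. snd p < X n \<omega>))"
      by (rule AE_finitely_many_upcrossings)
  qed
  with AE_frequently_bounded show ?thesis
  proof eventually_elim
    case (elim \<omega>)
    then obtain c where "\<exists>\<^sub>F n in sequentially. X n \<omega> < c" by blast
    with elim(2) show ?case
      by (intro convergent_if_no_oscillation[where c = c] nonneg) auto
  qed
qed

end

section \<open>Equilibrium loads\<close>

locale routing_game =
  fixes E :: "'e set" and R :: "'e list set" and S :: "'s set"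
    and \<l> :: "'e \<Rightarrow> 's \<Rightarrow> real \<Rightarrow> real" and \<alpha> D :: real
  assumes finite_E: "finite E" and finite_R: "finite R" and R_nonempty: "R \<noteq> {}"
    and routes_subset: "\<And>r. r \<in> R \<Longrightarrow> set r \<subseteq> E"
    and finite_S: "finite S"
    and cost_continuous: "\<And>e s. e \<in> E \<Longrightarrow> s \<in> S \<Longrightarrow> continuous_on {0..} (\<l> e s)"
    and \<alpha>_pos: "\<alpha> > 0"
    and cost_differentiable: "\<And>e s x. e \<in> E \<Longrightarrow> s \<in> S \<Longrightarrow> 0 < x \<Longrightarrow> \<l> e s differentiable (at x)"
    and cost_deriv: "\<And>e s x. e \<in> E \<Longrightarrow> s \<in> S \<Longrightarrow> 0 < x \<Longrightarrow> \<alpha> \<le> deriv (\<l> e s) x"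
    and D_pos: "D > 0"
begin

text \<open>Beliefs need not be normalised here, since rounding a belief, as in the proof of
  measurability, destroys the normalisation.\<close>
definition weights :: "('s \<Rightarrow> real) set" where
  "weights = {\<theta>. (\<forall>s\<in>S. 0 \<le> \<theta> s) \<and> 0 < (\<Sum>s\<in>S. \<theta> s)}"

definition edge_cost :: "('s \<Rightarrow> real) \<Rightarrow> 'e \<Rightarrow> real \<Rightarrow> real" where
  "edge_cost \<theta> e x = (\<Sum>s\<in>S. \<theta> s * \<l> e s x)"

lemma prob_vectors_weights: "\<theta> \<in> prob_vectors S \<Longrightarrow> \<theta> \<in> weights"
  by (auto simp: prob_vectors_def weights_def)

text \<open>\<open>\<l> e s z - \<alpha> * z\<close> has nonnegative derivative on the open
  interval; continuity takes care of the endpoint 0, where differentiability is not assumed.\<close>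

lemma cost_strongly_monotone:
  assumes "e \<in> E" "s \<in> S" "0 \<le> x" "x \<le> y"
  shows "\<alpha> * (y - x) \<le> \<l> e s y - \<l> e s x"
proof -
  have "\<l> e s x - \<alpha> * x \<le> \<l> e s y - \<alpha> * y"
  proof (rule DERIV_nonneg_imp_increasing_open[OF \<open>x \<le> y\<close>, of "\<lambda>z. \<l> e s z - \<alpha> * z"])
    fix z assume z: "x < z" "z < y"
    then have "(\<l> e s has_real_derivative deriv (\<l> e s) z) (at z)"
      using cost_differentiable[OF assms(1,2), of z] assms(3)
      by (simp add: DERIV_deriv_iff_real_differentiable)
    then have "((\<lambda>z. \<l> e s z - \<alpha> * z) has_real_derivative deriv (\<l> e s) z - \<alpha>) (at z)"
      by (auto intro!: derivative_eq_intros)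
    then show "\<exists>d. ((\<lambda>z. \<l> e s z - \<alpha> * z) has_real_derivative d) (at z) \<and> 0 \<le> d"
      using cost_deriv[OF assms(1,2), of z] z assms(3) by (intro exI) auto
  next
    show "continuous_on {x..y} (\<lambda>z. \<l> e s z - \<alpha> * z)"
      using assms(3) by (auto intro!: continuous_intros continuous_on_subset[OF cost_continuous[OF assms(1,2)]])
  qed
  then show ?thesis by (simp add: algebra_simps)
qed

lemma edge_cost_strongly_monotone:
  assumes "e \<in> E" "\<forall>s\<in>S. 0 \<le> \<theta> s" "0 \<le> x" "0 \<le> y"
  shows "\<alpha> * (\<Sum>s\<in>S. \<theta> s) * (y - x)\<^sup>2 \<le> (edge_cost \<theta> e y - edge_cost \<theta> e x) * (y - x)"
proof -
  have le: "\<alpha> * (y - x)\<^sup>2 \<le> (\<l> e s y - \<l> e s x) * (y - x)" if "s \<in> S" for s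
  proof (cases "x \<le> y")
    case True
    from mult_right_mono[OF cost_strongly_monotone[OF assms(1) that assms(3) True], of "y - x"] True
    show ?thesis by (simp add: power2_eq_square mult.assoc)
  next
    case False
    then have "y \<le> x" by simp
    from mult_right_mono[OF cost_strongly_monotone[OF assms(1) that assms(4) this], of "x - y"] this
    show ?thesis by (simp add: power2_eq_square algebra_simps)
  qed
  have "\<alpha> * (\<Sum>s\<in>S. \<theta> s) * (y - x)\<^sup>2 = (\<Sum>s\<in>S. \<theta> s * (\<alpha> * (y - x)\<^sup>2))"
    by (simp add: sum_distrib_left sum_distrib_right mult_ac)
  also have "\<dots> \<le> (\<Sum>s\<in>S. \<theta> s * ((\<l> e s y - \<l> e s x) * (y - x)))"
    using le assms(2) by (intro sum_mono mult_left_mono) auto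
  also have "\<dots> = (edge_cost \<theta> e y - edge_cost \<theta> e x) * (y - x)"
    unfolding edge_cost_def sum_subtractf[symmetric] sum_distrib_right
    by (intro sum.cong) (auto simp: algebra_simps)
  finally show ?thesis .
qed

lemma continuous_on_edge_cost: "e \<in> E \<Longrightarrow> continuous_on {0..} (edge_cost \<theta> e)"
  unfolding edge_cost_def by (intro continuous_on_sum continuous_on_mult continuous_on_const cost_continuous)

lemma edge_load_if: "edge_load R q e = (\<Sum>r\<in>R. if e \<in> set r then q r else 0)"
  using finite_R by (simp add: edge_load_def sum.inter_filter)

lemma edge_load_off: "e \<notin> E \<Longrightarrow> edge_load R q e = 0"
  unfolding edge_load_if by (intro sum.neutral) (use routes_subset in auto)

lemma edge_load_bounds:
  assumes "q \<in> strategies R D"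
  shows "0 \<le> edge_load R q e" "edge_load R q e \<le> D"
proof -
  have "(\<Sum>r\<in>R. if e \<in> set r then q r else 0) \<le> (\<Sum>r\<in>R. q r)"
    using assms by (intro sum_mono) (auto simp: strategies_def)
  then show "edge_load R q e \<le> D"
    using assms by (simp add: edge_load_if strategies_def)
  show "0 \<le> edge_load R q e"
    using assms unfolding edge_load_if by (intro sum_nonneg) (auto simp: strategies_def)
qed

section \<open>Variational characterisation of equilibria\<close>

text \<open>Double counting of pairs of a route and one of its edges. It turns conditions on routes
  into conditions on edge loads.\<close>

lemma sum_routes_eq_sum_edges:
  "(\<Sum>r\<in>R. p r * (\<Sum>e\<in>set r. c e)) = (\<Sum>e\<in>E. c e * edge_load R p e)"
proof -
  have "(\<Sum>r\<in>R. p r * (\<Sum>e\<in>set r. c e)) = (\<Sum>r\<in>R. \<Sum>e\<in>E. c e * (if e \<in> set r then p r else 0))"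
  proof (rule sum.cong[OF refl])
    fix r assume r: "r \<in> R"
    have "(\<Sum>e\<in>E. c e * (if e \<in> set r then p r else 0)) = (\<Sum>e\<in>E. if e \<in> set r then c e * p r else 0)"
      by (intro sum.cong) auto
    also have "\<dots> = (\<Sum>e\<in>set r. c e * p r)"
      using routes_subset[OF r] finite_E by (simp add: sum.If_cases Int_absorb1)
    finally show "p r * (\<Sum>e\<in>set r. c e) = (\<Sum>e\<in>E. c e * (if e \<in> set r then p r else 0))"
      by (simp add: sum_distrib_left mult.commute)
  qed
  also have "\<dots> = (\<Sum>e\<in>E. c e * edge_load R p e)"
    unfolding edge_load_if sum_distrib_left by (rule sum.swap)
  finally show ?thesis .
qed

lemma expected_route_cost_eq:
  "expected_route_cost S R \<l> \<theta> q r = (\<Sum>e\<in>set r. edge_cost \<theta> e (edge_load R q e))"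
  unfolding expected_route_cost_def route_cost_def edge_cost_def sum_distrib_left by (rule sum.swap)

lemma sum_expected_route_cost:
  "(\<Sum>r\<in>R. p r * expected_route_cost S R \<l> \<theta> q r) =
   (\<Sum>e\<in>E. edge_cost \<theta> e (edge_load R q e) * edge_load R p e)"
  unfolding expected_route_cost_eq by (rule sum_routes_eq_sum_edges)

text \<open>At the costs of \<open>q\<close> all used routes attain the minimum \<open>m\<close>, so
  \<open>q\<close> costs \<open>D * m\<close> in total, and no strategy of the same demand costs
  less.\<close>

lemma wardrop_variational_inequality:
  assumes "wardrop_equilibrium S R D \<l> \<theta> q" "q' \<in> strategies R D"
  shows "0 \<le> (\<Sum>e\<in>E. edge_cost \<theta> e (edge_load R q e) * (edge_load R q' e - edge_load R q e))"
proof -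
  let ?c = "expected_route_cost S R \<l> \<theta> q"
  have q: "q \<in> strategies R D" using assms(1) by (simp add: wardrop_equilibrium_def)
  define m where "m = Min (?c ` R)"
  have "(\<Sum>r\<in>R. q r * ?c r) = (\<Sum>r\<in>R. q r * m)"
  proof (rule sum.cong[OF refl])
    fix r assume "r \<in> R"
    then have "q r = 0 \<or> ?c r = m"
      using assms(1) q unfolding wardrop_equilibrium_def strategies_def m_def by force
    then show "q r * ?c r = q r * m" by auto
  qed
  also have "\<dots> = (\<Sum>r\<in>R. q' r * m)"
    using q assms(2) by (simp add: strategies_def sum_distrib_right[symmetric])
  also have "\<dots> \<le> (\<Sum>r\<in>R. q' r * ?c r)"
    using assms(2) finite_R by (intro sum_mono mult_left_mono) (auto simp: strategies_def m_def)
  finally show ?thesis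
    unfolding sum_expected_route_cost by (simp add: right_diff_distrib sum_subtractf)
qed

text \<open>Moving the whole flow of a used route \<open>r\<close> to another route
  \<open>r'\<close> is the only test made. Competitors agree with \<open>q\<close> off
  \<open>R\<close> because the lemma is applied to a minimiser among functions vanishing
  there.\<close>

lemma wardrop_if_variational_inequality:
  assumes q: "q \<in> strategies R D"
    and vi: "\<And>q'. q' \<in> strategies R D \<Longrightarrow> (\<And>r. r \<notin> R \<Longrightarrow> q' r = q r) \<Longrightarrow>
      0 \<le> (\<Sum>e\<in>E. edge_cost \<theta> e (edge_load R q e) * (edge_load R q' e - edge_load R q e))"
  shows "wardrop_equilibrium S R D \<l> \<theta> q"
proof -
  let ?c = "expected_route_cost S R \<l> \<theta> q"
  have "?c r \<le> ?c r'" if r: "r \<in> R" "q r > 0" and r': "r' \<in> R" for r r'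
  proof (cases "r = r'")
    case False
    define p where "p = (\<lambda>x. (if x = r' then q r else 0) - (if x = r then q r else 0))"
    have sum_p: "(\<Sum>x\<in>R. p x * h x) = q r * (h r' - h r)" for h
    proof -
      have "(\<Sum>x\<in>R. p x * h x) = (\<Sum>x\<in>R. if x = r' then q r * h x else 0) - (\<Sum>x\<in>R. if x = r then q r * h x else 0)"
        unfolding sum_subtractf[symmetric] by (intro sum.cong) (auto simp: p_def algebra_simps)
      then show ?thesis using finite_R r r' by (simp add: algebra_simps)
    qed
    define q' where "q' = (\<lambda>x. q x + p x)"
    have "(\<Sum>x\<in>R. q' x) = D"
      using sum_p[of "\<lambda>_. 1"] q by (simp add: q'_def sum.distrib strategies_def)
    then have "q' \<in> strategies R D"
      using q r by (auto simp: strategies_def q'_def p_def)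
    moreover have "q' x = q x" if "x \<notin> R" for x
      using that r r' by (auto simp: q'_def p_def)
    ultimately have "0 \<le> (\<Sum>x\<in>R. q' x * ?c x) - (\<Sum>x\<in>R. q x * ?c x)"
      using vi[of q'] unfolding sum_expected_route_cost by (simp add: right_diff_distrib sum_subtractf)
    also have "\<dots> = q r * (?c r' - ?c r)"
      unfolding q'_def distrib_right sum.distrib sum_p by simp
    finally show ?thesis using r by (simp add: zero_le_mult_iff)
  qed simp
  then have "?c r = Min (?c ` R)" if "r \<in> R" "q r > 0" for r
    using that finite_R by (intro Min_eqI[symmetric]) auto
  then show ?thesis using q by (simp add: wardrop_equilibrium_def)
qed

text \<open>Both variational inequalities added up; the first belief enters the right-hand side only
  through the costs at the fixed load of the second, so this gives uniqueness and continuity at once.\<close>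
lemma wardrop_load_stability:
  assumes \<theta>: "\<forall>s\<in>S. 0 \<le> \<theta> s"
    and q: "wardrop_equilibrium S R D \<l> \<theta> q" and q': "wardrop_equilibrium S R D \<l> \<theta>' q'"
  shows "\<alpha> * (\<Sum>s\<in>S. \<theta> s) * (\<Sum>e\<in>E. (edge_load R q e - edge_load R q' e)\<^sup>2)
    \<le> D * (\<Sum>e\<in>E. \<bar>edge_cost \<theta> e (edge_load R q' e) - edge_cost \<theta>' e (edge_load R q' e)\<bar>)"
proof -
  let ?w = "edge_load R q" and ?w' = "edge_load R q'"
  have qs: "q \<in> strategies R D" "q' \<in> strategies R D"
    using q q' by (auto simp: wardrop_equilibrium_def)
  have vi: "0 \<le> (\<Sum>e\<in>E. edge_cost \<theta> e (?w e) * (?w' e - ?w e)) +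
      (\<Sum>e\<in>E. edge_cost \<theta>' e (?w' e) * (?w e - ?w' e))"
    using wardrop_variational_inequality[OF q qs(2)] wardrop_variational_inequality[OF q' qs(1)] by simp
  have "\<alpha> * (\<Sum>s\<in>S. \<theta> s) * (\<Sum>e\<in>E. (?w e - ?w' e)\<^sup>2)
      \<le> (\<Sum>e\<in>E. (edge_cost \<theta> e (?w e) - edge_cost \<theta> e (?w' e)) * (?w e - ?w' e))"
    unfolding sum_distrib_left[of "\<alpha> * (\<Sum>s\<in>S. \<theta> s)"]
    using edge_load_bounds[OF qs(1)] edge_load_bounds[OF qs(2)]
    by (intro sum_mono edge_cost_strongly_monotone \<theta>) auto
  also have "\<dots> = (\<Sum>e\<in>E. (edge_cost \<theta> e (?w' e) - edge_cost \<theta>' e (?w' e)) * (?w' e - ?w e))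
      - ((\<Sum>e\<in>E. edge_cost \<theta> e (?w e) * (?w' e - ?w e)) +
         (\<Sum>e\<in>E. edge_cost \<theta>' e (?w' e) * (?w e - ?w' e)))"
    unfolding sum.distrib[symmetric] sum_subtractf[symmetric] by (intro sum.cong) (auto simp: algebra_simps)
  also have "\<dots> \<le> (\<Sum>e\<in>E. (edge_cost \<theta> e (?w' e) - edge_cost \<theta>' e (?w' e)) * (?w' e - ?w e))"
    using vi by simp
  also have "\<dots> \<le> (\<Sum>e\<in>E. \<bar>edge_cost \<theta> e (?w' e) - edge_cost \<theta>' e (?w' e)\<bar> * D)"
  proof (rule sum_mono)
    fix e
    have "\<bar>?w' e - ?w e\<bar> \<le> D"
      using edge_load_bounds[OF qs(1), of e] edge_load_bounds[OF qs(2), of e] by (auto simp: abs_if)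
    then have "\<bar>(edge_cost \<theta> e (?w' e) - edge_cost \<theta>' e (?w' e)) * (?w' e - ?w e)\<bar>
        \<le> \<bar>edge_cost \<theta> e (?w' e) - edge_cost \<theta>' e (?w' e)\<bar> * D"
      unfolding abs_mult by (intro mult_left_mono) auto
    then show "(edge_cost \<theta> e (?w' e) - edge_cost \<theta>' e (?w' e)) * (?w' e - ?w e)
        \<le> \<bar>edge_cost \<theta> e (?w' e) - edge_cost \<theta>' e (?w' e)\<bar> * D" by linarith
  qed
  finally show ?thesis by (simp add: sum_distrib_left mult.commute)
qed

text \<open>For equal beliefs the right-hand side of \<open>wardrop_load_stability\<close> vanishes.
  Off \<open>E\<close> both loads are 0, so they agree as functions.\<close>

lemma equilibrium_load_unique:
  assumes \<theta>: "\<theta> \<in> weights"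
    and w: "is_equilibrium_load S R D \<l> \<theta> w" "is_equilibrium_load S R D \<l> \<theta> w'"
  shows "w = w'"
proof
  fix e
  obtain q q' where q: "wardrop_equilibrium S R D \<l> \<theta> q" "w = edge_load R q"
    "wardrop_equilibrium S R D \<l> \<theta> q'" "w' = edge_load R q'"
    using w unfolding is_equilibrium_load_def by blast
  show "w e = w' e"
  proof (cases "e \<in> E")
    case True
    have "\<alpha> * (\<Sum>s\<in>S. \<theta> s) * (\<Sum>e\<in>E. (w e - w' e)\<^sup>2) \<le> 0"
      using wardrop_load_stability[OF _ q(1,3)] \<theta> q(2,4) by (simp add: weights_def)
    moreover have "0 < \<alpha> * (\<Sum>s\<in>S. \<theta> s)" using \<theta> \<alpha>_pos by (simp add: weights_def)
    ultimately have "(\<Sum>e\<in>E. (w e - w' e)\<^sup>2) \<le> 0" by (metis mult_le_cancel_left_pos mult_zero_right)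
    then have "(\<Sum>e\<in>E. (w e - w' e)\<^sup>2) = 0" by (intro antisym sum_nonneg) auto
    then show ?thesis using finite_E True by (simp add: sum_nonneg_eq_0_iff)
  next
    case False
    then show ?thesis by (simp add: q edge_load_off)
  qed
qed

section \<open>Existence of equilibria by minimisation\<close>

text \<open>The Beckmann potential, whose first-order condition is the variational
  inequality.\<close>

definition potential :: "('s \<Rightarrow> real) \<Rightarrow> ('e list \<Rightarrow> real) \<Rightarrow> real" where
  "potential \<theta> q = (\<Sum>e\<in>E. integral {0..edge_load R q e} (edge_cost \<theta> e))"

text \<open>Loads are affine along the segment, and the fundamental theorem of calculus applies edge
  by edge. The derivative is one-sided because costs are controlled on nonnegative loads
  only.\<close>

lemma potential_deriv:
  assumes q: "q \<in> strategies R D" and q': "q' \<in> strategies R D"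
  shows "((\<lambda>t. potential \<theta> (\<lambda>r. q r + t * (q' r - q r))) has_real_derivative
    (\<Sum>e\<in>E. edge_cost \<theta> e (edge_load R q e) * (edge_load R q' e - edge_load R q e))) (at 0 within {0..1})"
  unfolding potential_def
proof (rule DERIV_sum)
  fix e assume e: "e \<in> E"
  let ?w = "edge_load R q e" and ?w' = "edge_load R q' e"
  define g where "g t = ?w + t * (?w' - ?w)" for t
  have load: "edge_load R (\<lambda>r. q r + t * (q' r - q r)) e = g t" for t
    unfolding edge_load_def g_def by (simp add: sum.distrib sum_subtractf sum_distrib_left[symmetric])
  have g_range: "g ` {0..1} \<subseteq> {0..D}"
  proof
    fix y assume "y \<in> g ` {0..1}"
    then obtain t where t: "t \<in> {0..1}" "y = g t" by blast
    have "y = (1 - t) * ?w + t * ?w'" using t by (simp add: g_def algebra_simps)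
    then show "y \<in> {0..D}"
      using edge_load_bounds[OF q, of e] edge_load_bounds[OF q', of e] t(1)
        convex_bound_le[of ?w D ?w' "1 - t" t] by auto
  qed
  have "((\<lambda>x. integral {0..x} (edge_cost \<theta> e)) has_real_derivative edge_cost \<theta> e ?w) (at ?w within {0..D})"
    using edge_load_bounds[OF q, of e]
    by (intro integral_has_real_derivative continuous_on_subset[OF continuous_on_edge_cost[OF e]]) auto
  then have "((\<lambda>x. integral {0..x} (edge_cost \<theta> e)) has_real_derivative edge_cost \<theta> e ?w) (at (g 0) within g ` {0..1})"
    using g_range by (auto simp: g_def intro: DERIV_subset)
  moreover have "(g has_real_derivative (?w' - ?w)) (at 0 within {0..1})"
    unfolding g_def by (auto intro!: derivative_eq_intros)
  ultimately have "((\<lambda>x. integral {0..x} (edge_cost \<theta> e)) \<circ> g has_real_derivative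
      edge_cost \<theta> e ?w * (?w' - ?w)) (at 0 within {0..1})"
    by (rule DERIV_image_chain)
  then show "((\<lambda>t. integral {0..edge_load R (\<lambda>r. q r + t * (q' r - q r)) e} (edge_cost \<theta> e))
      has_real_derivative edge_cost \<theta> e ?w * (?w' - ?w)) (at 0 within {0..1})"
    unfolding load by (simp add: o_def)
qed

text \<open>\<open>strategies\<close> leaves the values off \<open>R\<close> free; fixing them at 0
  gives a compact set in the product topology.\<close>

definition extended_strategies :: "('e list \<Rightarrow> real) set" where
  "extended_strategies = {q \<in> strategies R D. \<forall>r. r \<notin> R \<longrightarrow> q r = 0}"

text \<open>Tychonoff's theorem for a product of intervals and points, cut by a closed
  hyperplane.\<close>

lemma compact_extended_strategies: "compact extended_strategies"
proof -
  let ?P = "PiE UNIV (\<lambda>r. if r \<in> R then {0..D} else {0::real})"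
  have "compactin (product_topology (\<lambda>_. euclidean) UNIV) ?P"
    by (subst compactin_PiE) auto
  then have "compact ?P" by (simp add: euclidean_product_topology)
  moreover have "closed {q :: 'e list \<Rightarrow> real. (\<Sum>r\<in>R. q r) = D}"
    by (intro closed_Collect_eq continuous_on_sum continuous_on_product_coordinates continuous_on_const)
  ultimately have "compact (?P \<inter> {q. (\<Sum>r\<in>R. q r) = D})" by (rule compact_Int_closed)
  also have "?P \<inter> {q. (\<Sum>r\<in>R. q r) = D} = extended_strategies"
  proof -
    have "q r \<le> D" if "\<forall>r\<in>R. 0 \<le> q r" "(\<Sum>r\<in>R. q r) = D" "r \<in> R" for q r
      using that member_le_sum[of r R q] finite_R by auto
    then show ?thesis
      by (auto simp: extended_strategies_def strategies_def PiE_iff split: if_splits)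
  qed
  finally show ?thesis .
qed

lemma continuous_on_potential: "continuous_on extended_strategies (potential \<theta>)"
  unfolding potential_def
proof (intro continuous_on_sum)
  fix e assume e: "e \<in> E"
  have "continuous_on {0..D} (\<lambda>x. integral {0..x} (edge_cost \<theta> e))"
    by (intro indefinite_integral_continuous_1 integrable_continuous_interval
        continuous_on_subset[OF continuous_on_edge_cost[OF e]]) auto
  moreover have "continuous_on extended_strategies (\<lambda>q. edge_load R q e)"
    unfolding edge_load_def
    by (intro continuous_on_sum continuous_on_subset[OF continuous_on_product_coordinates]) auto
  moreover have "(\<lambda>q. edge_load R q e) ` extended_strategies \<subseteq> {0..D}"
    using edge_load_bounds by (auto simp: extended_strategies_def)
  ultimately show "continuous_on extended_strategies (\<lambda>q. integral {0..edge_load R q e} (edge_cost \<theta> e))"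
    by (rule continuous_on_compose2)
qed

text \<open>A minimiser of the potential works: a negative directional derivative towards some
  \<open>q'\<close> would permit a small step that lowers the potential.\<close>

lemma wardrop_equilibrium_exists: "\<exists>q. wardrop_equilibrium S R D \<l> \<theta> q"
proof -
  obtain r\<^sub>0 where r0: "r\<^sub>0 \<in> R" using R_nonempty by blast
  have "(\<lambda>r. if r = r\<^sub>0 then D else 0) \<in> extended_strategies"
    using r0 finite_R D_pos by (auto simp: extended_strategies_def strategies_def)
  then obtain q where q: "q \<in> extended_strategies"
    and min: "\<And>q'. q' \<in> extended_strategies \<Longrightarrow> potential \<theta> q \<le> potential \<theta> q'"
    using continuous_attains_inf[OF compact_extended_strategies _ continuous_on_potential] by blast
  have "wardrop_equilibrium S R D \<l> \<theta> q"
  proof (rule wardrop_if_variational_inequality)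
    show qs: "q \<in> strategies R D" using q by (simp add: extended_strategies_def)
    fix q' assume q': "q' \<in> strategies R D" "\<And>r. r \<notin> R \<Longrightarrow> q' r = q r"
    let ?d = "\<Sum>e\<in>E. edge_cost \<theta> e (edge_load R q e) * (edge_load R q' e - edge_load R q e)"
    show "0 \<le> ?d"
    proof (rule ccontr)
      assume "\<not> 0 \<le> ?d"
      then obtain \<delta> where \<delta>: "\<delta> > 0"
        "\<And>h. 0 < h \<Longrightarrow> 0 + h \<in> {0..1} \<Longrightarrow> h < \<delta> \<Longrightarrow>
          potential \<theta> (\<lambda>r. q r + (0 + h) * (q' r - q r)) < potential \<theta> (\<lambda>r. q r + 0 * (q' r - q r))"
        using has_real_derivative_neg_dec_right[OF potential_deriv[OF qs q'(1)]] by (auto simp: not_le)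
      define h where "h = min 1 (\<delta> / 2)"
      have h: "0 < h" "h \<le> 1" "h < \<delta>" using \<delta>(1) by (auto simp: h_def)
      have "(\<lambda>r. q r + h * (q' r - q r)) \<in> extended_strategies"
      proof -
        have "0 \<le> q r + h * (q' r - q r)" if "r \<in> R" for r
        proof -
          have "0 \<le> (1 - h) * q r + h * q' r"
            using that qs q'(1) h by (auto simp: strategies_def)
          then show ?thesis by (simp add: algebra_simps)
        qed
        moreover have "(\<Sum>r\<in>R. q r + h * (q' r - q r)) = D"
          using qs q'(1) by (simp add: strategies_def sum.distrib sum_distrib_left[symmetric] sum_subtractf)
        ultimately show ?thesis
          using q q'(2) by (auto simp: extended_strategies_def strategies_def)
      qed
      from min[OF this] \<delta>(2)[of h] h show False by simp
    qed
  qed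
  then show ?thesis by blast
qed

section \<open>The equilibrium load as a function of the belief\<close>

lemma is_equilibrium_load_equilibrium_load:
  assumes "\<theta> \<in> weights"
  shows "is_equilibrium_load S R D \<l> \<theta> (equilibrium_load S R D \<l> \<theta>)"
  unfolding equilibrium_load_def
proof (rule theI'[of "is_equilibrium_load S R D \<l> \<theta>"])
  have "\<exists>w. is_equilibrium_load S R D \<l> \<theta> w"
    using wardrop_equilibrium_exists[of \<theta>] unfolding is_equilibrium_load_def by blast
  then show "\<exists>!w. is_equilibrium_load S R D \<l> \<theta> w"
    using equilibrium_load_unique[OF assms] by blast
qed

lemma equilibrium_loadE:
  assumes "\<theta> \<in> weights"
  obtains q where "wardrop_equilibrium S R D \<l> \<theta> q" "equilibrium_load S R D \<l> \<theta> = edge_load R q"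
  using is_equilibrium_load_equilibrium_load[OF assms] unfolding is_equilibrium_load_def by blast

lemma equilibrium_load_nonneg: "\<theta> \<in> weights \<Longrightarrow> 0 \<le> equilibrium_load S R D \<l> \<theta> e"
  by (metis equilibrium_loadE edge_load_bounds(1) wardrop_equilibrium_def)

lemma equilibrium_load_mem: "\<theta> \<in> weights \<Longrightarrow> equilibrium_load S R D \<l> \<theta> \<in> edge_load R ` strategies R D"
  by (metis equilibrium_loadE imageI wardrop_equilibrium_def)

text \<open>\<open>wardrop_load_stability\<close> bounds the squared distance by \<open>err\<close>,
  where only costs at the fixed limit load occur. The \<open>\<theta>n n\<close> are merely
  nonnegative, since rounding down may produce the zero function; they lie in \<open>weights\<close>
  from some \<open>n\<close> on.\<close>

lemma tendsto_equilibrium_load: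
  assumes \<theta>: "\<theta> \<in> weights" and nonneg: "\<And>n s. s \<in> S \<Longrightarrow> 0 \<le> \<theta>n n s"
    and lim: "\<And>s. s \<in> S \<Longrightarrow> (\<lambda>n. \<theta>n n s) \<longlonglongrightarrow> \<theta> s"
  shows "(\<lambda>n. equilibrium_load S R D \<l> (\<theta>n n) e) \<longlonglongrightarrow> equilibrium_load S R D \<l> \<theta> e"
proof -
  obtain q where q: "wardrop_equilibrium S R D \<l> \<theta> q" "equilibrium_load S R D \<l> \<theta> = edge_load R q"
    by (rule equilibrium_loadE[OF \<theta>])
  let ?w = "edge_load R q"
  let ?wn = "\<lambda>n. equilibrium_load S R D \<l> (\<theta>n n)"
  have sum_lim: "(\<lambda>n. \<Sum>s\<in>S. \<theta>n n s) \<longlonglongrightarrow> (\<Sum>s\<in>S. \<theta> s)" by (intro tendsto_sum lim)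
  then have pos: "eventually (\<lambda>n. 0 < (\<Sum>s\<in>S. \<theta>n n s)) sequentially"
    using \<theta> by (intro order_tendstoD(1)) (auto simp: weights_def)
  define err where "err n = (D * (\<Sum>e\<in>E. \<bar>edge_cost (\<theta>n n) e (?w e) - edge_cost \<theta> e (?w e)\<bar>)) /
      (\<alpha> * (\<Sum>s\<in>S. \<theta>n n s))" for n
  have "(\<lambda>n. edge_cost (\<theta>n n) e x) \<longlonglongrightarrow> edge_cost \<theta> e x" for e x
    unfolding edge_cost_def by (intro tendsto_sum tendsto_mult lim tendsto_const)
  then have "err \<longlonglongrightarrow> (D * (\<Sum>e\<in>E. \<bar>edge_cost \<theta> e (?w e) - edge_cost \<theta> e (?w e)\<bar>)) / (\<alpha> * (\<Sum>s\<in>S. \<theta> s))"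
    unfolding err_def using \<theta> \<alpha>_pos
    by (intro tendsto_divide tendsto_mult tendsto_sum tendsto_rabs tendsto_diff tendsto_const lim)
      (auto simp: weights_def)
  then have err_lim: "err \<longlonglongrightarrow> 0" by simp
  have err_bound: "eventually (\<lambda>n. (?wn n e - ?w e)\<^sup>2 \<le> err n) sequentially"
    using pos
  proof eventually_elim
    case (elim n)
    then have "\<theta>n n \<in> weights" using nonneg by (auto simp: weights_def)
    then obtain q' where q': "wardrop_equilibrium S R D \<l> (\<theta>n n) q'" "?wn n = edge_load R q'"
      by (rule equilibrium_loadE)
    show ?case
    proof (cases "e \<in> E")
      case True
      have "(?wn n e - ?w e)\<^sup>2 \<le> (\<Sum>e\<in>E. (?wn n e - ?w e)\<^sup>2)"
        using member_le_sum[OF True, of "\<lambda>e. (?wn n e - ?w e)\<^sup>2"] finite_E by simp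
      also have "\<dots> \<le> err n"
        using wardrop_load_stability[OF _ q'(1) q(1)] nonneg elim \<alpha>_pos q'(2)
        by (simp add: err_def pos_le_divide_eq mult.commute)
      finally show ?thesis .
    next
      case False
      have "0 \<le> err n" using elim \<alpha>_pos D_pos by (simp add: err_def sum_nonneg)
      with False show ?thesis by (simp add: q' edge_load_off)
    qed
  qed
  have "(\<lambda>n. (?wn n e - ?w e)\<^sup>2) \<longlonglongrightarrow> 0"
    by (rule tendsto_sandwich[OF _ err_bound tendsto_const err_lim]) simp
  then have "(\<lambda>n. ?wn n e - ?w e) \<longlonglongrightarrow> 0"
    by simp
  then show ?thesis unfolding q(2) by (simp add: LIM_zero_iff)
qed

text \<open>The state space carries no topology, so measurability is obtained by rounding the
  belief to a countable grid instead of from continuity of a map between topological spaces.\<close>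
lemma borel_measurable_equilibrium_load:
  assumes \<theta>[measurable]: "\<And>s. s \<in> S \<Longrightarrow> (\<lambda>\<omega>. \<theta> \<omega> s) \<in> borel_measurable N"
    and w: "\<And>\<omega>. \<omega> \<in> space N \<Longrightarrow> \<theta> \<omega> \<in> weights"
  shows "(\<lambda>\<omega>. equilibrium_load S R D \<l> (\<theta> \<omega>) e) \<in> borel_measurable N"
proof -
  \<comment> \<open>Rounding down keeps the weights nonnegative and takes values in a countable
    discrete space, on which every function is measurable.\<close>
  define g where "g n \<omega> = (\<lambda>s\<in>S. \<lfloor>real (Suc n) * \<theta> \<omega> s\<rfloor>)" for n \<omega>
  define \<rho> where "\<rho> n k s = real_of_int (k s) / real (Suc n)" for n and k :: "'s \<Rightarrow> int" and s
  have count: "countable (\<Pi>\<^sub>E s\<in>S. UNIV :: int set)"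
    by (intro countable_PiE finite_S) auto
  have g: "g n \<in> measurable N (count_space (\<Pi>\<^sub>E s\<in>S. UNIV :: int set))" for n
    unfolding measurable_count_space_eq_countable[OF count]
  proof (intro conjI ballI)
    fix k assume k: "k \<in> (\<Pi>\<^sub>E s\<in>S. UNIV :: int set)"
    have "g n -` {k} \<inter> space N = {\<omega> \<in> space N. \<forall>s\<in>S. \<lfloor>real (Suc n) * \<theta> \<omega> s\<rfloor> = k s}"
      using k by (auto simp: g_def PiE_iff fun_eq_iff extensional_def)
    also have "\<dots> \<in> sets N"
      by (intro sets.sets_Collect_finite_All finite_S) measurable
    finally show "g n -` {k} \<inter> space N \<in> sets N" .
  qed (auto simp: g_def)
  have meas: "(\<lambda>\<omega>. equilibrium_load S R D \<l> (\<rho> n (g n \<omega>)) e) \<in> borel_measurable N" for n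
    by (rule measurable_compose[OF g]) simp
  show ?thesis
  proof (rule borel_measurable_LIMSEQ_real[OF _ meas])
    fix \<omega> assume \<omega>: "\<omega> \<in> space N"
    show "(\<lambda>n. equilibrium_load S R D \<l> (\<rho> n (g n \<omega>)) e) \<longlonglongrightarrow> equilibrium_load S R D \<l> (\<theta> \<omega>) e"
    proof (rule tendsto_equilibrium_load[OF w[OF \<omega>]])
      fix s assume s: "s \<in> S"
      have nn: "0 \<le> \<theta> \<omega> s" using w[OF \<omega>] s by (simp add: weights_def)
      show "0 \<le> \<rho> n (g n \<omega>) s" for n using nn s by (simp add: \<rho>_def g_def)
      have bounds: "\<theta> \<omega> s - 1 / real (Suc n) \<le> \<rho> n (g n \<omega>) s" "\<rho> n (g n \<omega>) s \<le> \<theta> \<omega> s" for n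
      proof -
        have "(real (Suc n) * \<theta> \<omega> s - 1) / real (Suc n) \<le> real_of_int \<lfloor>real (Suc n) * \<theta> \<omega> s\<rfloor> / real (Suc n)"
          "real_of_int \<lfloor>real (Suc n) * \<theta> \<omega> s\<rfloor> / real (Suc n) \<le> (real (Suc n) * \<theta> \<omega> s) / real (Suc n)"
          by (intro divide_right_mono; linarith)+
        then show "\<theta> \<omega> s - 1 / real (Suc n) \<le> \<rho> n (g n \<omega>) s" "\<rho> n (g n \<omega>) s \<le> \<theta> \<omega> s"
          using s by (simp_all add: \<rho>_def g_def diff_divide_distrib del: of_nat_Suc)
      qed
      have "(\<lambda>n. \<theta> \<omega> s - 1 / real (Suc n)) \<longlonglongrightarrow> \<theta> \<omega> s - 0"
        by (intro tendsto_diff tendsto_const) (rule LIMSEQ_Suc[OF lim_1_over_n])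
      then have lim: "(\<lambda>n. \<theta> \<omega> s - 1 / real (Suc n)) \<longlonglongrightarrow> \<theta> \<omega> s" by simp
      show "(\<lambda>n. \<rho> n (g n \<omega>) s) \<longlonglongrightarrow> \<theta> \<omega> s"
        by (rule tendsto_sandwich[OF _ _ lim tendsto_const]) (use bounds in auto)
    qed
  qed
qed

end

section \<open>Learning dynamics\<close>

locale learning = routing_game E R S \<l> \<alpha> D + prob_space M
  for E :: "'e set" and R :: "'e list set" and S :: "'s set"
    and \<l> :: "'e \<Rightarrow> 's \<Rightarrow> real \<Rightarrow> real" and \<alpha> D :: real and M :: "'a measure" +
  fixes s\<^sub>0 :: 's and C :: "'e \<Rightarrow> 'e \<Rightarrow> real" and \<epsilon> :: "nat \<Rightarrow> 'a \<Rightarrow> 'e \<Rightarrow> real" and \<theta>\<^sub>0 :: "'s \<Rightarrow> real"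
  assumes s0_in_S: "s\<^sub>0 \<in> S"
    and covariance: "nondegenerate_covariance_on E C"
    and noise_indep: "indep_vars (\<lambda>_. \<Pi>\<^sub>M e\<in>E. lborel) \<epsilon> {1..}"
    and noise_gaussian: "\<And>k. 1 \<le> k \<Longrightarrow> distributed M (\<Pi>\<^sub>M e\<in>E. lborel) (\<epsilon> k)
        (\<lambda>x. ennreal (gaussian_density_on E (\<lambda>_. 0) C x))"
    and prior: "\<theta>\<^sub>0 \<in> prob_vectors S" and prior_pos: "\<And>s. s \<in> S \<Longrightarrow> 0 < \<theta>\<^sub>0 s"
begin

abbreviation noise_space :: "('e \<Rightarrow> real) measure" where
  "noise_space \<equiv> \<Pi>\<^sub>M e\<in>E. lborel"

definition \<theta> :: "nat \<Rightarrow> 'a \<Rightarrow> 's \<Rightarrow> real" where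
  "\<theta> k \<omega> = belief E S R D \<l> C s\<^sub>0 \<theta>\<^sub>0 (\<lambda>j. \<epsilon> j \<omega>) k"

text \<open>The load of stage \<open>k + 1\<close>.\<close>
definition load :: "nat \<Rightarrow> 'a \<Rightarrow> 'e \<Rightarrow> real" where
  "load k \<omega> = equilibrium_load S R D \<l> (\<theta> k \<omega>)"

text \<open>The observed cost gap between \<open>s\<close> and the true state, multiplied by the inverse
  covariance of the used edges. With it the log-likelihood ratio is an expression over all
  edges, in which only the covariance itself occurs.\<close>
definition tilt :: "('e \<Rightarrow> real) \<Rightarrow> 's \<Rightarrow> 'e \<Rightarrow> real" where
  "tilt w s e = (if e \<in> used_edges E w
     then \<Sum>f\<in>used_edges E w. inverse_on (used_edges E w) C e f * (\<l> f s (w f) - \<l> f s\<^sub>0 (w f))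
     else 0)"

text \<open>Twice the Kullback-Leibler divergence between the laws of the observation under
  \<open>s\<close> and under the true state.\<close>

definition info :: "nat \<Rightarrow> 's \<Rightarrow> 'a \<Rightarrow> real" where
  "info k s \<omega> = quad_form_on E C (tilt (load k \<omega>) s)"

text \<open>The closed form is taken as definition, so positivity and powers are immediate;
  \<open>likelihood_eq\<close> identifies it with the quotient of densities.\<close>

definition likelihood_ratio :: "nat \<Rightarrow> 's \<Rightarrow> 'a \<Rightarrow> real" where
  "likelihood_ratio k s \<omega> =
     exp ((\<Sum>e\<in>E. tilt (load k \<omega>) s e * \<epsilon> (Suc k) \<omega> e) - info k s \<omega> / 2)"

definition odds :: "'s \<Rightarrow> nat \<Rightarrow> 'a \<Rightarrow> real" where
  "odds s k \<omega> = \<theta> k \<omega> s / \<theta> k \<omega> s\<^sub>0"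

text \<open>Generated by the full noise vectors, also on unobserved edges: beliefs are adapted to it
  and the next noise is independent of it.\<close>

definition history :: "nat \<Rightarrow> 'a measure" where
  "history k = vimage_algebra (space M) (\<lambda>\<omega>. \<lambda>j\<in>{1..k}. \<epsilon> j \<omega>) (\<Pi>\<^sub>M j\<in>{1..k}. noise_space)"

section \<open>Bayes' rule in terms of likelihood ratios\<close>

lemma used_edges_subset: "used_edges E w \<subseteq> E"
  by (auto simp: used_edges_def)

lemma finite_used_edges: "finite (used_edges E w)"
  using finite_E used_edges_subset by (rule rev_finite_subset)

lemma covariance_used_edges: "nondegenerate_covariance_on (used_edges E w) C"
  using covariance used_edges_subset finite_E by (rule nondegenerate_covariance_on_subset)

lemma sum_tilt: "(\<Sum>e\<in>E. tilt w s e * h e) = (\<Sum>e\<in>used_edges E w. tilt w s e * h e)"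
  using finite_E used_edges_subset by (intro sum.mono_neutral_right) (auto simp: tilt_def)

lemma covariance_tilt:
  assumes "e \<in> used_edges E w"
  shows "(\<Sum>f\<in>E. C e f * tilt w s f) = \<l> e s (w e) - \<l> e s\<^sub>0 (w e)"
proof -
  have "(\<Sum>f\<in>E. C e f * tilt w s f) = (\<Sum>f\<in>used_edges E w. C e f * tilt w s f)"
    using sum_tilt[of w s "C e"] by (simp add: mult.commute)
  also have "\<dots> = (\<Sum>f\<in>used_edges E w. C e f * (\<Sum>g\<in>used_edges E w.
      inverse_on (used_edges E w) C f g * (\<l> g s (w g) - \<l> g s\<^sub>0 (w g))))"
    by (intro sum.cong) (auto simp: tilt_def)
  also have "\<dots> = \<l> e s (w e) - \<l> e s\<^sub>0 (w e)"
    by (rule sum_mult_inverse_on(1)[OF covariance_used_edges finite_used_edges assms])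
  finally show ?thesis .
qed

lemma tilt_true_state: "tilt w s\<^sub>0 e = 0"
  by (simp add: tilt_def)

lemma quad_form_on_tilt: "quad_form_on E C (tilt w s) = quad_form_on (used_edges E w) C (tilt w s)"
proof -
  have q: "quad_form_on I C (tilt w s) = (\<Sum>i\<in>I. tilt w s i * (\<Sum>j\<in>I. tilt w s j * C i j))" for I
    by (simp add: quad_form_on_def sum_distrib_left mult_ac)
  show ?thesis unfolding q sum_tilt ..
qed

lemma likelihood_eq:
  "likelihood E \<l> C w (\<lambda>e. \<l> e s\<^sub>0 (w e) + \<eta> e) s =
   likelihood E \<l> C w (\<lambda>e. \<l> e s\<^sub>0 (w e) + \<eta> e) s\<^sub>0 *
   exp ((\<Sum>e\<in>E. tilt w s e * \<eta> e) - quad_form_on E C (tilt w s) / 2)"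
proof -
  let ?J = "used_edges E w"
  have "(\<Sum>j\<in>?J. C i j * tilt w s j) = \<l> i s (w i) - \<l> i s\<^sub>0 (w i)" if "i \<in> ?J" for i
    using covariance_tilt[OF that, of s] sum_tilt[of w s "C i"] by (simp add: mult.commute)
  then have "likelihood E \<l> C w (\<lambda>e. \<l> e s\<^sub>0 (w e) + \<eta> e) s =
      likelihood E \<l> C w (\<lambda>e. \<l> e s\<^sub>0 (w e) + \<eta> e) s\<^sub>0 *
      exp ((\<Sum>e\<in>?J. tilt w s e * ((\<l> e s\<^sub>0 (w e) + \<eta> e) - \<l> e s\<^sub>0 (w e))) - quad_form_on ?J C (tilt w s) / 2)"
    unfolding likelihood_def
    by (intro gaussian_density_on_shift[OF covariance_used_edges finite_used_edges]) simp
  then show ?thesis by (simp add: sum_tilt quad_form_on_tilt)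
qed

lemma \<theta>_Suc:
  assumes "s \<in> S"
  shows "\<theta> (Suc k) \<omega> s =
    \<theta> k \<omega> s * likelihood_ratio k s \<omega> / (\<Sum>s'\<in>S. \<theta> k \<omega> s' * likelihood_ratio k s' \<omega>)"
proof -
  let ?w = "load k \<omega>"
  let ?L = "likelihood E \<l> C ?w (\<lambda>e. \<l> e s\<^sub>0 (?w e) + \<epsilon> (Suc k) \<omega> e)"
  have L: "?L s' = ?L s\<^sub>0 * likelihood_ratio k s' \<omega>" for s'
    unfolding likelihood_ratio_def info_def by (rule likelihood_eq)
  have nz: "?L s\<^sub>0 \<noteq> 0"
    unfolding likelihood_def by (rule gaussian_density_on_nonzero[OF covariance_used_edges finite_used_edges])
  have "\<theta> (Suc k) \<omega> s = \<theta> k \<omega> s * ?L s / (\<Sum>s'\<in>S. \<theta> k \<omega> s' * ?L s')"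
    by (simp add: \<theta>_def load_def Let_def bayes_update_def)
  also have "(\<Sum>s'\<in>S. \<theta> k \<omega> s' * ?L s') = ?L s\<^sub>0 * (\<Sum>s'\<in>S. \<theta> k \<omega> s' * likelihood_ratio k s' \<omega>)"
    unfolding sum_distrib_left by (intro sum.cong refl) (subst L, simp)
  finally show ?thesis using nz by (subst (asm) L) simp
qed

lemma likelihood_ratio_pos: "0 < likelihood_ratio k s \<omega>"
  by (simp add: likelihood_ratio_def)

lemma \<theta>_pos: "s \<in> S \<Longrightarrow> 0 < \<theta> k \<omega> s"
proof (induction k arbitrary: s)
  case 0
  then show ?case by (simp add: \<theta>_def prior_pos)
next
  case (Suc k)
  then have "0 < (\<Sum>s'\<in>S. \<theta> k \<omega> s' * likelihood_ratio k s' \<omega>)"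
    using finite_S by (intro sum_pos) (auto simp: likelihood_ratio_pos)
  then show ?case
    using Suc by (simp add: \<theta>_Suc likelihood_ratio_pos)
qed

lemma \<theta>_prob_vectors: "\<theta> k \<omega> \<in> prob_vectors S"
proof (cases k)
  case 0
  then show ?thesis using prior by (simp add: \<theta>_def)
next
  case (Suc n)
  have "0 < (\<Sum>s'\<in>S. \<theta> n \<omega> s' * likelihood_ratio n s' \<omega>)"
    using finite_S s0_in_S by (intro sum_pos) (auto simp: likelihood_ratio_pos \<theta>_pos)
  then have "(\<Sum>s\<in>S. \<theta> k \<omega> s) = 1"
    by (simp add: Suc \<theta>_Suc sum_divide_distrib[symmetric])
  then show ?thesis by (auto simp: prob_vectors_def intro: less_imp_le \<theta>_pos)
qed

lemma \<theta>_weights: "\<theta> k \<omega> \<in> weights"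
  by (rule prob_vectors_weights[OF \<theta>_prob_vectors])

lemma load_nonneg: "0 \<le> load k \<omega> e"
  unfolding load_def by (rule equilibrium_load_nonneg[OF \<theta>_weights])

lemma odds_pos: "s \<in> S \<Longrightarrow> 0 < odds s k \<omega>"
  by (simp add: odds_def \<theta>_pos s0_in_S)

text \<open>The normalising sum of Bayes' rule cancels in the quotient, so the odds evolve
  multiplicatively.\<close>

lemma odds_Suc:
  assumes "s \<in> S"
  shows "odds s (Suc k) \<omega> = odds s k \<omega> * likelihood_ratio k s \<omega>"
proof -
  have "likelihood_ratio k s\<^sub>0 \<omega> = 1"
    by (simp add: likelihood_ratio_def info_def quad_form_on_def tilt_true_state)
  moreover have "0 < (\<Sum>s'\<in>S. \<theta> k \<omega> s' * likelihood_ratio k s' \<omega>)"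
    using finite_S s0_in_S by (intro sum_pos) (auto simp: likelihood_ratio_pos \<theta>_pos)
  ultimately show ?thesis
    using assms s0_in_S by (simp add: odds_def \<theta>_Suc)
qed

text \<open>Carries convergence of the odds back to the beliefs.\<close>

lemma \<theta>_eq_odds:
  assumes "s \<in> S"
  shows "\<theta> k \<omega> s = odds s k \<omega> / (\<Sum>s'\<in>S. odds s' k \<omega>)"
proof -
  have "(\<Sum>s'\<in>S. odds s' k \<omega>) = 1 / \<theta> k \<omega> s\<^sub>0"
    using \<theta>_prob_vectors[of k \<omega>] by (simp add: odds_def prob_vectors_def sum_divide_distrib[symmetric])
  then show ?thesis
    using \<theta>_pos[OF s0_in_S, of k \<omega>] by (simp add: odds_def)
qed

section \<open>Filtration and measurability\<close>

lemma noise_measurable: "1 \<le> k \<Longrightarrow> \<epsilon> k \<in> measurable M noise_space"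
  using noise_gaussian by (auto simp: distributed_def)

lemma history_map_measurable: "(\<lambda>\<omega>. \<lambda>j\<in>{1..k}. \<epsilon> j \<omega>) \<in> measurable M (\<Pi>\<^sub>M j\<in>{1..k}. noise_space)"
  by (intro measurable_restrict noise_measurable) auto

lemma space_history: "space (history k) = space M"
  by (simp add: history_def)

lemma noise_measurable_history:
  assumes "j \<in> {1..k}"
  shows "\<epsilon> j \<in> measurable (history k) noise_space"
proof -
  have "(\<lambda>\<omega>. \<lambda>j\<in>{1..k}. \<epsilon> j \<omega>) \<in> measurable (history k) (\<Pi>\<^sub>M j\<in>{1..k}. noise_space)"
    unfolding history_def
    by (rule measurable_vimage_algebra1) (use measurable_space[OF history_map_measurable] in auto)
  then have "(\<lambda>\<omega>. (\<lambda>j\<in>{1..k}. \<epsilon> j \<omega>) j) \<in> measurable (history k) noise_space"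
    by (rule measurable_compose) (rule measurable_component_singleton[OF assms])
  with assms show ?thesis by simp
qed

lemma sets_history_mono: "sets (history k) \<subseteq> sets (history (Suc k))"
proof -
  have "(\<lambda>\<omega>. \<omega>) \<in> measurable (history (Suc k)) (history k)"
    unfolding history_def[of k]
    by (rule measurable_vimage_algebra2)
      (auto simp: space_history intro!: measurable_restrict noise_measurable_history)
  then show ?thesis
    using sets.sets_into_space[of _ "history k"]
    by (auto simp: measurable_def space_history Int_absorb2)
qed

lemma subalgebra_history: "subalgebra M (history k)"
proof -
  have "(\<lambda>\<omega>. \<omega>) \<in> measurable M (history k)"
    unfolding history_def by (rule measurable_vimage_algebra2) (use history_map_measurable in auto)
  then show ?thesis
    using sets.sets_into_space[of _ "history k"]
    by (auto simp: subalgebra_def measurable_def space_history Int_absorb2)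
qed

lemma measurable_history_imp_Suc: "f \<in> measurable (history k) N \<Longrightarrow> f \<in> measurable (history (Suc k)) N"
  using measurable_mono[OF order_refl refl sets_history_mono[of k], of N] by (auto simp: space_history)

lemma measurable_history_imp: "f \<in> measurable (history k) N \<Longrightarrow> f \<in> measurable M N"
  using subalgebra_history by (rule measurable_from_subalg)

lemma cost_measurable:
  assumes e: "e \<in> E" "s \<in> S" and f: "f \<in> borel_measurable N" "\<And>\<omega>. \<omega> \<in> space N \<Longrightarrow> 0 \<le> f \<omega>"
  shows "(\<lambda>\<omega>. \<l> e s (f \<omega>)) \<in> borel_measurable N"
proof -
  \<comment> \<open>Costs are continuous on nonnegative loads only, so they are first extended
    constantly to the left of 0.\<close>
  have "continuous_on UNIV (\<lambda>x. \<l> e s (max 0 x))"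
    by (rule continuous_on_compose2[OF cost_continuous[OF e]]) (auto intro!: continuous_intros)
  then have "(\<lambda>x. \<l> e s (max 0 x)) \<in> borel_measurable borel"
    by (rule borel_measurable_continuous_onI)
  from measurable_compose[OF f(1) this] have "(\<lambda>\<omega>. \<l> e s (max 0 (f \<omega>))) \<in> borel_measurable N" .
  then show ?thesis using f(2) by (simp add: max_absorb2 cong: measurable_cong)
qed

text \<open>The set of used edges takes finitely many values; for each of them the inverse matrix is
  constant and the tilt is a measurable expression in the loads.\<close>

lemma tilt_measurable:
  assumes s: "s \<in> S" and W[measurable]: "\<And>e. e \<in> E \<Longrightarrow> (\<lambda>\<omega>. W \<omega> e) \<in> borel_measurable N"
    and nonneg: "\<And>\<omega> e. \<omega> \<in> space N \<Longrightarrow> e \<in> E \<Longrightarrow> 0 \<le> W \<omega> e"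
  shows "(\<lambda>\<omega>. tilt (W \<omega>) s e) \<in> borel_measurable N"
proof -
  define t where "t J \<omega> = (if e \<in> J
     then \<Sum>f\<in>J. inverse_on J C e f * (\<l> f s (W \<omega> f) - \<l> f s\<^sub>0 (W \<omega> f)) else 0)" for J \<omega>
  have count: "countable (Pow E)" using finite_E by (simp add: countable_finite)
  have used: "(\<lambda>\<omega>. used_edges E (W \<omega>)) \<in> measurable N (count_space (Pow E))"
    unfolding measurable_count_space_eq_countable[OF count]
  proof (intro conjI ballI)
    fix J assume "J \<in> Pow E"
    then have "(\<lambda>\<omega>. used_edges E (W \<omega>)) -` {J} \<inter> space N = {\<omega> \<in> space N. \<forall>f\<in>E. (0 < W \<omega> f) = (f \<in> J)}"
      by (auto simp: used_edges_def)
    also have "\<dots> \<in> sets N"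
      by (intro sets.sets_Collect_finite_All finite_E) measurable
    finally show "(\<lambda>\<omega>. used_edges E (W \<omega>)) -` {J} \<inter> space N \<in> sets N" .
  qed (auto simp: used_edges_def)
  have t: "t J \<in> borel_measurable N" if "J \<in> Pow E" for J
  proof -
    have "(\<lambda>\<omega>. \<Sum>f\<in>J. inverse_on J C e f * (\<l> f s (W \<omega> f) - \<l> f s\<^sub>0 (W \<omega> f))) \<in> borel_measurable N"
      using that s s0_in_S nonneg
      by (intro borel_measurable_sum borel_measurable_times borel_measurable_diff borel_measurable_const cost_measurable W) auto
    then show ?thesis by (cases "e \<in> J") (simp_all add: t_def[abs_def])
  qed
  have "(\<lambda>\<omega>. t (used_edges E (W \<omega>)) \<omega>) \<in> borel_measurable N"
    by (rule measurable_compose_countable'[OF t used count])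
  then show ?thesis by (simp add: t_def tilt_def)
qed

lemma load_measurable_if:
  assumes "\<And>s. s \<in> S \<Longrightarrow> (\<lambda>\<omega>. \<theta> k \<omega> s) \<in> borel_measurable N"
  shows "(\<lambda>\<omega>. load k \<omega> e) \<in> borel_measurable N"
  unfolding load_def using assms \<theta>_weights by (rule borel_measurable_equilibrium_load)

lemma \<theta>_measurable: "s \<in> S \<Longrightarrow> (\<lambda>\<omega>. \<theta> k \<omega> s) \<in> borel_measurable (history k)"
proof (induction k arbitrary: s)
  case 0
  then show ?case by (simp add: \<theta>_def)
next
  case (Suc k)
  let ?N = "history (Suc k)"
  have \<theta>: "(\<lambda>\<omega>. \<theta> k \<omega> s) \<in> borel_measurable ?N" if "s \<in> S" for s
    by (rule measurable_history_imp_Suc[OF Suc.IH[OF that]])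
  have tilt: "(\<lambda>\<omega>. tilt (load k \<omega>) s e) \<in> borel_measurable ?N" if "s \<in> S" for s e
    using that by (intro tilt_measurable load_measurable_if \<theta> load_nonneg)
  have noise: "(\<lambda>\<omega>. \<epsilon> (Suc k) \<omega> e) \<in> borel_measurable ?N" if "e \<in> E" for e
    using measurable_compose[OF noise_measurable_history[of "Suc k" "Suc k"] measurable_component_singleton[OF that]]
    by simp
  have "(\<lambda>\<omega>. likelihood_ratio k s \<omega>) \<in> borel_measurable ?N" if "s \<in> S" for s
    unfolding likelihood_ratio_def info_def quad_form_on_def using tilt[OF that] noise by measurable
  with \<theta> show ?case
    using Suc.prems by (simp add: \<theta>_Suc)
qed

lemma load_measurable: "(\<lambda>\<omega>. load k \<omega> e) \<in> borel_measurable (history k)"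
  by (intro load_measurable_if \<theta>_measurable)

lemma tilt_load_measurable: "s \<in> S \<Longrightarrow> (\<lambda>\<omega>. tilt (load k \<omega>) s e) \<in> borel_measurable (history k)"
  by (intro tilt_measurable load_measurable load_nonneg)

lemma info_measurable: "s \<in> S \<Longrightarrow> info k s \<in> borel_measurable (history k)"
  unfolding info_def[abs_def] quad_form_on_def using tilt_load_measurable by measurable

lemma odds_measurable: "s \<in> S \<Longrightarrow> odds s k \<in> borel_measurable (history k)"
  unfolding odds_def[abs_def] using \<theta>_measurable s0_in_S by measurable

lemma info_nonneg: "0 \<le> info k s \<omega>"
  unfolding info_def by (rule quad_form_on_nonneg[OF covariance])

section \<open>Conditional moments of the likelihood ratio\<close>

text \<open>By independence the past may be frozen, and with it \<open>v\<close>; the Gaussian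
  exponential moment is then taken in the new noise alone. The weight \<open>g\<close> stands in for
  conditioning on the past.\<close>

lemma nn_integral_exp_noise:
  assumes g: "g \<in> borel_measurable (history k)"
    and v: "\<And>e. e \<in> E \<Longrightarrow> (\<lambda>\<omega>. v \<omega> e) \<in> borel_measurable (history k)"
  shows "(\<integral>\<^sup>+\<omega>. g \<omega> * ennreal (exp (\<Sum>e\<in>E. v \<omega> e * \<epsilon> (Suc k) \<omega> e)) \<partial>M) =
    (\<integral>\<^sup>+\<omega>. g \<omega> * ennreal (exp (quad_form_on E C (v \<omega>) / 2)) \<partial>M)"
proof -
  let ?\<phi> = "\<lambda>x. ennreal (gaussian_density_on E (\<lambda>_. 0) C x)"
  have dist: "distr M noise_space (\<epsilon> (Suc k)) = density noise_space ?\<phi>"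
    and \<phi>: "?\<phi> \<in> borel_measurable noise_space"
    using noise_gaussian[of "Suc k"] by (auto simp: distributed_def)
  interpret Y: prob_space "distr M noise_space (\<epsilon> (Suc k))"
    by (rule prob_space_distr[OF noise_measurable]) simp
  \<comment> \<open>The normalisation of the density comes from its being the density of a random
    variable.\<close>
  have one: "(\<integral>\<^sup>+x. ?\<phi> x \<partial>noise_space) = 1"
  proof -
    have "(\<integral>\<^sup>+x. ?\<phi> x \<partial>noise_space) = (\<integral>\<^sup>+x. ?\<phi> x * indicator (space noise_space) x \<partial>noise_space)"
      by (intro nn_integral_cong) auto
    also have "\<dots> = emeasure (density noise_space ?\<phi>) (space noise_space)"
      using \<phi> by (intro emeasure_density[symmetric]) auto
    also have "\<dots> = 1" using Y.emeasure_space_1 by (simp add: dist)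
    finally show ?thesis .
  qed
  have coord: "(\<lambda>y. y e) \<in> borel_measurable noise_space" if "e \<in> E" for e
    using measurable_component_singleton[OF that, of "\<lambda>_. lborel"] by simp
  define f where "f = (\<lambda>(\<omega>, y). g \<omega> * ennreal (exp (\<Sum>e\<in>E. v \<omega> e * y e)))"
  have f: "f \<in> borel_measurable (history k \<Otimes>\<^sub>M noise_space)"
  proof -
    have y: "(\<lambda>z. snd z e) \<in> borel_measurable (history k \<Otimes>\<^sub>M noise_space)" if "e \<in> E" for e
      by (rule measurable_compose[OF measurable_snd coord[OF that]])
    note measurable_compose[OF measurable_fst v, measurable]
    note measurable_compose[OF measurable_fst g, measurable]
    show ?thesis unfolding f_def split_beta using y by measurable
  qed
  have "(\<integral>\<^sup>+\<omega>. f (\<omega>, \<epsilon> (Suc k) \<omega>) \<partial>M) = (\<integral>\<^sup>+\<omega>. (\<integral>\<^sup>+y. f (\<omega>, y) \<partial>distr M noise_space (\<epsilon> (Suc k))) \<partial>M)"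
    by (rule nn_integral_indep_history[OF noise_indep, of "{1..k}" "Suc k"])
      (use f in \<open>auto simp: history_def\<close>)
  also have "\<dots> = (\<integral>\<^sup>+\<omega>. g \<omega> * ennreal (exp (quad_form_on E C (v \<omega>) / 2)) \<partial>M)"
  proof (rule nn_integral_cong)
    fix \<omega>
    have m: "(\<lambda>y. ennreal (exp (\<Sum>e\<in>E. v \<omega> e * y e))) \<in> borel_measurable noise_space"
      using coord by measurable
    have "(\<integral>\<^sup>+y. f (\<omega>, y) \<partial>distr M noise_space (\<epsilon> (Suc k))) =
        g \<omega> * (\<integral>\<^sup>+y. ennreal (exp (\<Sum>e\<in>E. v \<omega> e * y e)) \<partial>density noise_space ?\<phi>)"
      unfolding dist f_def split_conv using m by (intro nn_integral_cmult) simp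
    also have "(\<integral>\<^sup>+y. ennreal (exp (\<Sum>e\<in>E. v \<omega> e * y e)) \<partial>density noise_space ?\<phi>) =
        (\<integral>\<^sup>+y. ?\<phi> y * ennreal (exp (\<Sum>e\<in>E. v \<omega> e * y e)) \<partial>noise_space)"
      by (rule nn_integral_density[OF \<phi> m])
    also have "\<dots> = ennreal (exp (quad_form_on E C (v \<omega>) / 2))"
      by (rule gaussian_density_on_mgf[OF covariance finite_E \<phi> one])
    finally show "(\<integral>\<^sup>+y. f (\<omega>, y) \<partial>distr M noise_space (\<epsilon> (Suc k))) =
        g \<omega> * ennreal (exp (quad_form_on E C (v \<omega>) / 2))" .
  qed
  finally show ?thesis by (simp add: f_def)
qed

text \<open>The definition of the ratio contributes \<open>- t * I / 2\<close> to the exponent and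
  the exponential moment at \<open>t\<close> times the tilt contributes
  \<open>t * t * I / 2\<close>, with \<open>I\<close> the \<open>info\<close> of the stage.\<close>

lemma nn_integral_likelihood_ratio_power:
  assumes s: "s \<in> S" and g[measurable]: "g \<in> borel_measurable (history k)"
  shows "(\<integral>\<^sup>+\<omega>. g \<omega> * ennreal (likelihood_ratio k s \<omega> powr t) \<partial>M) =
    (\<integral>\<^sup>+\<omega>. g \<omega> * ennreal (exp (- (t * (1 - t)) * info k s \<omega> / 2)) \<partial>M)"
proof -
  let ?v = "\<lambda>\<omega> e. t * tilt (load k \<omega>) s e"
  let ?g = "\<lambda>\<omega>. g \<omega> * ennreal (exp (- t * info k s \<omega> / 2))"
  note info_measurable[OF s, measurable] tilt_load_measurable[OF s, measurable]
  have q: "quad_form_on E C (?v \<omega>) = t\<^sup>2 * info k s \<omega>" for \<omega>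
    by (simp add: quad_form_on_def info_def sum_distrib_left power2_eq_square mult_ac)
  have "g \<omega> * ennreal (likelihood_ratio k s \<omega> powr t) =
      ?g \<omega> * ennreal (exp (\<Sum>e\<in>E. ?v \<omega> e * \<epsilon> (Suc k) \<omega> e))" for \<omega>
  proof -
    have "likelihood_ratio k s \<omega> powr t =
        exp (- t * info k s \<omega> / 2) * exp (\<Sum>e\<in>E. ?v \<omega> e * \<epsilon> (Suc k) \<omega> e)"
      by (simp add: likelihood_ratio_def powr_def exp_add[symmetric] sum_distrib_left algebra_simps)
    then show ?thesis by (simp add: ennreal_mult mult.assoc)
  qed
  then have "(\<integral>\<^sup>+\<omega>. g \<omega> * ennreal (likelihood_ratio k s \<omega> powr t) \<partial>M) =
      (\<integral>\<^sup>+\<omega>. ?g \<omega> * ennreal (exp (quad_form_on E C (?v \<omega>) / 2)) \<partial>M)"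
    by (subst nn_integral_exp_noise[of ?g k ?v, symmetric]) simp_all
  also have "\<dots> = (\<integral>\<^sup>+\<omega>. g \<omega> * ennreal (exp (- (t * (1 - t)) * info k s \<omega> / 2)) \<partial>M)"
  proof (rule nn_integral_cong)
    fix \<omega>
    have "exp (- t * info k s \<omega> / 2) * exp (t\<^sup>2 * info k s \<omega> / 2) = exp (- (t * (1 - t)) * info k s \<omega> / 2)"
      by (simp add: exp_add[symmetric] power2_eq_square field_simps)
    then show "?g \<omega> * ennreal (exp (quad_form_on E C (?v \<omega>) / 2)) =
        g \<omega> * ennreal (exp (- (t * (1 - t)) * info k s \<omega> / 2))"
      unfolding q by (simp add: ennreal_mult[symmetric] mult.assoc)
  qed
  finally show ?thesis .
qed

lemma nn_integral_odds_Suc: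
  assumes s: "s \<in> S" and A: "A \<in> sets (history k)"
  shows "(\<integral>\<^sup>+\<omega>. ennreal (indicator A \<omega> * odds s (Suc k) \<omega>) \<partial>M) = (\<integral>\<^sup>+\<omega>. ennreal (indicator A \<omega> * odds s k \<omega>) \<partial>M)"
proof -
  have "(\<lambda>\<omega>. ennreal (indicator A \<omega> * odds s k \<omega>)) \<in> borel_measurable (history k)"
    using A odds_measurable[OF s] by measurable
  \<comment> \<open>At \<open>t = 1\<close> the two contributions cancel: the martingale
    property.\<close>
  from nn_integral_likelihood_ratio_power[OF s this, of 1] show ?thesis
    using odds_pos[OF s]
    by (simp add: odds_Suc[OF s] ennreal_mult[symmetric] likelihood_ratio_pos less_imp_le mult.assoc)
qed

lemma odds_initial: "odds s 0 \<omega> = \<theta>\<^sub>0 s / \<theta>\<^sub>0 s\<^sub>0"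
  by (simp add: odds_def \<theta>_def)

lemma nn_integral_odds:
  assumes s: "s \<in> S"
  shows "(\<integral>\<^sup>+\<omega>. ennreal (odds s k \<omega>) \<partial>M) = ennreal (\<theta>\<^sub>0 s / \<theta>\<^sub>0 s\<^sub>0)"
proof (induction k)
  case 0
  then show ?case by (simp add: odds_initial emeasure_space_1)
next
  case (Suc k)
  have "(\<integral>\<^sup>+\<omega>. ennreal (odds s n \<omega>) \<partial>M) = (\<integral>\<^sup>+\<omega>. ennreal (indicator (space M) \<omega> * odds s n \<omega>) \<partial>M)" for n
    by (intro nn_integral_cong) simp
  with nn_integral_odds_Suc[OF s, of "space M" k] sets.top[of "history k"] Suc show ?case
    by (simp add: space_history)
qed

lemma integrable_odds: "s \<in> S \<Longrightarrow> integrable M (odds s k)"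
  using nn_integral_odds[of s k] measurable_history_imp[OF odds_measurable[of s k]] odds_pos[of s k]
  by (intro integrableI_nonneg) (auto intro: less_imp_le)

lemma supermartingale_odds:
  assumes s: "s \<in> S"
  shows "nonneg_supermartingale M history (odds s)"
proof
  fix k A assume A: "A \<in> sets (history k)"
  have AM: "A \<in> sets M" using A subalgebra_history[of k] by (auto simp: subalgebra_def)
  have "(\<integral>\<omega>. indicator A \<omega> * odds s n \<omega> \<partial>M) = enn2real (\<integral>\<^sup>+\<omega>. ennreal (indicator A \<omega> * odds s n \<omega>) \<partial>M)" for n
    using AM measurable_history_imp[OF odds_measurable[OF s, of n]] less_imp_le[OF odds_pos[OF s]]
    by (intro integral_eq_nn_integral AE_I2 mult_nonneg_nonneg) auto
  then show "(\<integral>\<omega>. indicator A \<omega> * odds s (Suc k) \<omega> \<partial>M) \<le> (\<integral>\<omega>. indicator A \<omega> * odds s k \<omega> \<partial>M)"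
    by (simp only: nn_integral_odds_Suc[OF s A])
next
  show "0 \<le> odds s k \<omega>" for k \<omega> using odds_pos[OF s] by (rule less_imp_le)
qed (auto simp: subalgebra_history odds_measurable[OF s] integrable_odds[OF s] subsetD[OF sets_history_mono])

text \<open>The square root of the likelihood ratio is a supermartingale whose expected decrease in
  one stage is governed by \<open>info\<close>; the decreases telescope.\<close>
lemma AE_sqrt_odds_info:
  assumes s: "s \<in> S"
  shows "AE \<omega> in M. (\<lambda>k. sqrt (odds s k \<omega>) * (1 - exp (- info k s \<omega> / 8))) \<longlonglongrightarrow> 0"
proof -
  let ?a = "\<lambda>k \<omega>. sqrt (odds s k \<omega>) * (1 - exp (- info k s \<omega> / 8))"
  note odds_measurable[OF s, measurable] info_measurable[OF s, measurable]
  have a_nonneg: "0 \<le> ?a k \<omega>" for k \<omega>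
    using info_nonneg[of k s \<omega>] odds_pos[OF s, of k \<omega>] by (intro mult_nonneg_nonneg) auto
  have a_meas: "(\<lambda>\<omega>. ennreal (?a k \<omega>)) \<in> borel_measurable M" for k
    by (rule measurable_history_imp[where k = k]) measurable
  have step: "(\<integral>\<^sup>+\<omega>. ennreal (sqrt (odds s k \<omega>)) \<partial>M) =
      (\<integral>\<^sup>+\<omega>. ennreal (sqrt (odds s (Suc k) \<omega>)) \<partial>M) + (\<integral>\<^sup>+\<omega>. ennreal (?a k \<omega>) \<partial>M)" for k
  proof -
    have m: "(\<lambda>\<omega>. ennreal (sqrt (odds s k \<omega>))) \<in> borel_measurable (history k)" by measurable
    have m': "(\<lambda>\<omega>. ennreal (sqrt (odds s k \<omega>) * exp (- info k s \<omega> / 8))) \<in> borel_measurable M"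
      by (rule measurable_history_imp[where k = k]) measurable
    have "(\<integral>\<^sup>+\<omega>. ennreal (sqrt (odds s (Suc k) \<omega>)) \<partial>M) =
        (\<integral>\<^sup>+\<omega>. ennreal (sqrt (odds s k \<omega>)) * ennreal (likelihood_ratio k s \<omega> powr (1 / 2)) \<partial>M)"
      using odds_pos[OF s]
      by (simp add: odds_Suc[OF s] real_sqrt_mult ennreal_mult powr_half_sqrt likelihood_ratio_pos less_imp_le)
    \<comment> \<open>The case \<open>t = 1 / 2\<close>, where \<open>t * (1 - t) / 2\<close> is
      \<open>1 / 8\<close>.\<close>
    also have "\<dots> = (\<integral>\<^sup>+\<omega>. ennreal (sqrt (odds s k \<omega>) * exp (- info k s \<omega> / 8)) \<partial>M)"
      unfolding nn_integral_likelihood_ratio_power[OF s m]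
      by (intro nn_integral_cong) (simp add: ennreal_mult'')
    finally have "(\<integral>\<^sup>+\<omega>. ennreal (sqrt (odds s (Suc k) \<omega>)) \<partial>M) + (\<integral>\<^sup>+\<omega>. ennreal (?a k \<omega>) \<partial>M) =
        (\<integral>\<^sup>+\<omega>. ennreal (sqrt (odds s k \<omega>) * exp (- info k s \<omega> / 8)) + ennreal (?a k \<omega>) \<partial>M)"
      by (simp only: nn_integral_add[OF m' a_meas])
    also have "\<dots> = (\<integral>\<^sup>+\<omega>. ennreal (sqrt (odds s k \<omega>)) \<partial>M)"
      using a_nonneg odds_pos[OF s]
      by (intro nn_integral_cong) (simp add: ennreal_plus[symmetric] less_imp_le algebra_simps del: ennreal_plus)
    finally show ?thesis ..
  qed
  \<comment> \<open>The expected losses of all stages together are at most the initial square root,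
    so almost every path has summable losses.\<close>
  have "(\<integral>\<^sup>+\<omega>. ennreal (sqrt (odds s n \<omega>)) \<partial>M) + (\<Sum>k<n. \<integral>\<^sup>+\<omega>. ennreal (?a k \<omega>) \<partial>M) =
      ennreal (sqrt (\<theta>\<^sub>0 s / \<theta>\<^sub>0 s\<^sub>0))" for n
  proof (induction n)
    case (Suc n)
    then show ?case unfolding step[of n] by (simp add: add_ac)
  qed (simp add: odds_initial emeasure_space_1)
  note telescope = this
  have "(\<Sum>k<n. \<integral>\<^sup>+\<omega>. ennreal (?a k \<omega>) \<partial>M) \<le> ennreal (sqrt (\<theta>\<^sub>0 s / \<theta>\<^sub>0 s\<^sub>0))" for n
    unfolding telescope[of n, symmetric] by (rule add_increasing) simp_all
  then have "(\<Sum>k. \<integral>\<^sup>+\<omega>. ennreal (?a k \<omega>) \<partial>M) \<le> ennreal (sqrt (\<theta>\<^sub>0 s / \<theta>\<^sub>0 s\<^sub>0))"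
    by (intro suminf_le_const) auto
  then have "(\<integral>\<^sup>+\<omega>. (\<Sum>k. ennreal (?a k \<omega>)) \<partial>M) \<noteq> \<infinity>"
    by (subst nn_integral_suminf[OF a_meas]) (auto simp: top_unique)
  then have "AE \<omega> in M. (\<Sum>k. ennreal (?a k \<omega>)) \<noteq> \<infinity>"
    using a_meas by (intro nn_integral_noteq_infinite borel_measurable_suminf) auto
  then show ?thesis
  proof eventually_elim
    case (elim \<omega>)
    then have "summable (\<lambda>k. ?a k \<omega>)"
      using a_nonneg by (intro summable_suminf_not_top) auto
    then show ?case by (rule summable_LIMSEQ_zero)
  qed
qed

section \<open>Limits of beliefs and loads\<close>

text \<open>The default \<open>\<theta>\<^sub>0\<close> makes this a probability vector at every
  \<open>\<omega>\<close>, also where the beliefs fail to converge.\<close>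

definition \<theta>_limit :: "'a \<Rightarrow> 's \<Rightarrow> real" where
  "\<theta>_limit \<omega> = (if \<forall>s\<in>S. convergent (\<lambda>k. \<theta> k \<omega> s) then (\<lambda>s. lim (\<lambda>k. \<theta> k \<omega> s)) else \<theta>\<^sub>0)"

definition load_limit :: "'a \<Rightarrow> 'e \<Rightarrow> real" where
  "load_limit \<omega> = equilibrium_load S R D \<l> (\<theta>_limit \<omega>)"

lemma tendsto_\<theta>_limit:
  assumes "\<forall>s\<in>S. convergent (\<lambda>k. \<theta> k \<omega> s)" "s \<in> S"
  shows "(\<lambda>k. \<theta> k \<omega> s) \<longlonglongrightarrow> \<theta>_limit \<omega> s"
  using assms by (simp add: \<theta>_limit_def convergent_LIMSEQ_iff)

lemma \<theta>_limit_prob_vectors: "\<theta>_limit \<omega> \<in> prob_vectors S"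
proof (cases "\<forall>s\<in>S. convergent (\<lambda>k. \<theta> k \<omega> s)")
  case True
  note lim = tendsto_\<theta>_limit[OF True]
  have "(\<lambda>k. \<Sum>s\<in>S. \<theta> k \<omega> s) \<longlonglongrightarrow> (\<Sum>s\<in>S. \<theta>_limit \<omega> s)" by (intro tendsto_sum lim)
  moreover have "(\<Sum>s\<in>S. \<theta> k \<omega> s) = 1" for k using \<theta>_prob_vectors by (simp add: prob_vectors_def)
  ultimately have "(\<Sum>s\<in>S. \<theta>_limit \<omega> s) = 1" by (simp add: LIMSEQ_const_iff)
  moreover have "0 \<le> \<theta>_limit \<omega> s" if "s \<in> S" for s
    using \<theta>_pos[OF that] by (intro LIMSEQ_le_const[OF lim[OF that]]) (auto intro: less_imp_le)
  ultimately show ?thesis by (simp add: prob_vectors_def)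
next
  case False
  then show ?thesis unfolding \<theta>_limit_def if_not_P[OF False] using prior by simp
qed

lemma \<theta>_limit_measurable:
  assumes s: "s \<in> S"
  shows "(\<lambda>\<omega>. \<theta>_limit \<omega> s) \<in> borel_measurable M"
proof -
  have m: "(\<lambda>\<omega>. \<theta> k \<omega> s) \<in> borel_measurable M" if "s \<in> S" for k s
    by (rule measurable_history_imp[OF \<theta>_measurable[OF that]])
  have "{\<omega> \<in> space M. \<forall>s\<in>S. convergent (\<lambda>k. \<theta> k \<omega> s)} \<in> sets M"
    unfolding Cauchy_convergent_iff[symmetric]
    by (intro sets.sets_Collect_finite_All finite_S sets_Collect_Cauchy m)
  moreover have "(\<lambda>\<omega>. lim (\<lambda>k. \<theta> k \<omega> s)) \<in> borel_measurable M"
    by (intro borel_measurable_lim_metric m s)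
  ultimately have "(\<lambda>\<omega>. if \<forall>s\<in>S. convergent (\<lambda>k. \<theta> k \<omega> s) then lim (\<lambda>k. \<theta> k \<omega> s) else \<theta>\<^sub>0 s) \<in> borel_measurable M"
    by (intro measurable_If) auto
  moreover have "\<theta>_limit \<omega> s = (if \<forall>s\<in>S. convergent (\<lambda>k. \<theta> k \<omega> s) then lim (\<lambda>k. \<theta> k \<omega> s) else \<theta>\<^sub>0 s)" for \<omega>
    by (simp add: \<theta>_limit_def)
  ultimately show ?thesis by simp
qed

lemma \<theta>_limit_weights: "\<theta>_limit \<omega> \<in> weights"
  by (rule prob_vectors_weights[OF \<theta>_limit_prob_vectors])

lemma load_limit_measurable: "(\<lambda>\<omega>. load_limit \<omega> e) \<in> borel_measurable M"
  unfolding load_limit_def using \<theta>_limit_measurable \<theta>_limit_weights by (rule borel_measurable_equilibrium_load)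

lemma tendsto_load_limit:
  assumes "\<forall>s\<in>S. convergent (\<lambda>k. \<theta> k \<omega> s)"
  shows "(\<lambda>k. load k \<omega> e) \<longlonglongrightarrow> load_limit \<omega> e"
  unfolding load_def load_limit_def
  by (rule tendsto_equilibrium_load[OF \<theta>_limit_weights])
    (auto intro: tendsto_\<theta>_limit[OF assms] less_imp_le \<theta>_pos)

text \<open>A cost gap on an edge used in the limit would keep \<open>info\<close> away from zero.\<close>
lemma costs_equal_if_info_vanishes:
  assumes conv: "\<forall>s\<in>S. convergent (\<lambda>k. \<theta> k \<omega> s)"
    and info: "(\<lambda>k. info k s \<omega>) \<longlonglongrightarrow> 0" and s: "s \<in> S" and e: "e \<in> E" "0 < load_limit \<omega> e"
  shows "\<l> e s (load_limit \<omega> e) = \<l> e s\<^sub>0 (load_limit \<omega> e)"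
proof -
  let ?gap = "\<lambda>x. \<l> e s x - \<l> e s\<^sub>0 x"
  note lim = tendsto_load_limit[OF conv, of e]
  \<comment> \<open>The limit load is positive, so differentiability there yields two-sided
    continuity.\<close>
  have cont: "isCont (\<l> e s') (load_limit \<omega> e)" if "s' \<in> S" for s'
    using cost_differentiable[OF e(1) that e(2)] differentiable_imp_continuous_within by blast
  have "(\<lambda>k. (?gap (load k \<omega> e))\<^sup>2) \<longlonglongrightarrow> (?gap (load_limit \<omega> e))\<^sup>2"
    by (intro tendsto_power tendsto_diff isCont_tendsto_compose[OF cont lim] s s0_in_S)
  moreover have "(\<lambda>k. (?gap (load k \<omega> e))\<^sup>2) \<longlonglongrightarrow> 0"
  proof (rule tendsto_sandwich[OF _ _ tendsto_const])
    \<comment> \<open>The factor \<open>C e e\<close> does not depend on the set of used edges,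
      which may vary with \<open>k\<close>.\<close>
    show "(\<lambda>k. C e e * info k s \<omega>) \<longlonglongrightarrow> 0" using tendsto_mult_left[OF info, of "C e e"] by simp
    have "\<forall>\<^sub>F k in sequentially. 0 < load k \<omega> e" using lim e(2) by (rule order_tendstoD(1))
    then show "\<forall>\<^sub>F k in sequentially. (?gap (load k \<omega> e))\<^sup>2 \<le> C e e * info k s \<omega>"
    proof eventually_elim
      case (elim k)
      then have "e \<in> used_edges E (load k \<omega>)" using e(1) by (simp add: used_edges_def)
      from covariance_tilt[OF this, of s]
      show ?case
        using square_le_quad_form_on[OF covariance finite_E e(1), of "tilt (load k \<omega>) s"]
        by (simp add: info_def)
    qed
  qed simp
  ultimately have "(?gap (load_limit \<omega> e))\<^sup>2 = 0" by (rule LIMSEQ_unique)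
  then show ?thesis by simp
qed

lemma AE_limit:
  "AE \<omega> in M. (\<forall>s\<in>S. convergent (\<lambda>k. \<theta> k \<omega> s)) \<and>
     (\<forall>s\<in>distinguishable_states E S \<l> s\<^sub>0 (load_limit \<omega>). \<theta>_limit \<omega> s = 0)"
proof -
  have "AE \<omega> in M. \<forall>s\<in>S. convergent (\<lambda>k. odds s k \<omega>) \<and>
      (\<lambda>k. sqrt (odds s k \<omega>) * (1 - exp (- info k s \<omega> / 8))) \<longlonglongrightarrow> 0"
    using nonneg_supermartingale.AE_convergent[OF supermartingale_odds] AE_sqrt_odds_info finite_S
    by (intro AE_finite_allI AE_conjI) auto
  then show ?thesis
  proof eventually_elim
    case (elim \<omega>)
    define x where "x s = lim (\<lambda>k. odds s k \<omega>)" for s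
    have x: "(\<lambda>k. odds s k \<omega>) \<longlonglongrightarrow> x s" if "s \<in> S" for s
      using elim that by (simp add: x_def convergent_LIMSEQ_iff)
    have x_nonneg: "0 \<le> x s" if "s \<in> S" for s
      using odds_pos[OF that] by (intro LIMSEQ_le_const[OF x[OF that]]) (auto intro: less_imp_le)
    \<comment> \<open>The true state keeps the limit of the normalising sum away from 0.\<close>
    have "odds s\<^sub>0 k \<omega> = 1" for k using \<theta>_pos[OF s0_in_S, of k \<omega>] by (simp add: odds_def)
    then have "x s\<^sub>0 = 1" by (simp add: x_def)
    then have sum_pos: "0 < (\<Sum>s\<in>S. x s)"
      using sum_pos2[OF finite_S s0_in_S, of x] x_nonneg by simp
    have \<theta>_lim: "(\<lambda>k. \<theta> k \<omega> s) \<longlonglongrightarrow> x s / (\<Sum>s\<in>S. x s)" if "s \<in> S" for s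
      unfolding \<theta>_eq_odds[OF that] using sum_pos
      by (intro tendsto_divide tendsto_sum x that) auto
    then have conv: "\<forall>s\<in>S. convergent (\<lambda>k. \<theta> k \<omega> s)" by (auto intro: convergentI)
    have "\<theta>_limit \<omega> s = 0" if dist: "s \<in> distinguishable_states E S \<l> s\<^sub>0 (load_limit \<omega>)" for s
    proof (rule ccontr)
      assume nz: "\<theta>_limit \<omega> s \<noteq> 0"
      have s: "s \<in> S" using dist by (simp add: distinguishable_states_def)
      have "\<theta>_limit \<omega> s = x s / (\<Sum>s\<in>S. x s)"
        using tendsto_\<theta>_limit[OF conv s] \<theta>_lim[OF s] by (rule LIMSEQ_unique)
      with nz have "sqrt (x s) \<noteq> 0" by auto
      \<comment> \<open>The limit odds are positive, so dividing by their square root isolates the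
        factor with \<open>info\<close>.\<close>
      then have "(\<lambda>k. sqrt (odds s k \<omega>) * (1 - exp (- info k s \<omega> / 8)) / sqrt (odds s k \<omega>)) \<longlonglongrightarrow> 0 / sqrt (x s)"
        using elim s by (intro tendsto_divide tendsto_real_sqrt x) auto
      moreover have "sqrt (odds s k \<omega>) \<noteq> 0" for k
        using odds_pos[OF s, of k \<omega>] by simp
      ultimately have "(\<lambda>k. 1 - exp (- info k s \<omega> / 8)) \<longlonglongrightarrow> 0" by simp
      from tendsto_diff[OF tendsto_const[of 1] this]
      have "(\<lambda>k. exp (- info k s \<omega> / 8)) \<longlonglongrightarrow> 1" by simp
      from tendsto_ln[OF this] have "(\<lambda>k. - info k s \<omega> / 8) \<longlonglongrightarrow> 0" by simp
      from tendsto_mult_left[OF this, of "- 8"] have "(\<lambda>k. info k s \<omega>) \<longlonglongrightarrow> 0" by simp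
      from costs_equal_if_info_vanishes[OF conv this s] dist show False
        by (auto simp: distinguishable_states_def)
    qed
    with conv show ?case by blast
  qed
qed

end

theorem theorem1:
  fixes G :: "('v, 'e) pre_digraph" and orig dest :: 'v
    and R :: "'e list set"
    and S :: "'s set" and s\<^sub>0 :: 's
    and \<l> :: "'e \<Rightarrow> 's \<Rightarrow> real \<Rightarrow> real"
    and \<alpha> D :: real
    and Cov :: "'e \<Rightarrow> 'e \<Rightarrow> real"
    and M :: "'a measure" and \<epsilon> :: "nat \<Rightarrow> 'a \<Rightarrow> 'e \<Rightarrow> real"
    and \<theta>\<^sub>0 :: "'s \<Rightarrow> real"
  defines "\<theta> \<equiv> \<lambda>k \<omega>. belief (arcs G) S R D \<l> Cov s\<^sub>0 \<theta>\<^sub>0 (\<lambda>j. \<epsilon> j \<omega>) k"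
    and "w \<equiv> \<lambda>k \<omega>. stage_load (arcs G) S R D \<l> Cov s\<^sub>0 \<theta>\<^sub>0 (\<lambda>j. \<epsilon> j \<omega>) k"
  assumes graph: "fin_digraph G"
    and routes: "R \<noteq> {}" "\<forall>r\<in>R. pre_digraph.apath G orig r dest"
    and states: "finite S" "s\<^sub>0 \<in> S"
    and cost_continuous: "\<forall>e\<in>arcs G. \<forall>s\<in>S. continuous_on {0..} (\<l> e s)"
    and cost_increasing: "\<forall>e\<in>arcs G. \<forall>s\<in>S. strict_mono_on {0..} (\<l> e s)"
    and cost_derivative: "\<alpha> > 0"
      "\<forall>e\<in>arcs G. \<forall>s\<in>S. \<forall>x>0. \<l> e s differentiable (at x) \<and> deriv (\<l> e s) x \<ge> \<alpha>"
    and demand: "D > 0"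
    and prob: "prob_space M"
    and covariance: "nondegenerate_covariance_on (arcs G) Cov"
    and noise_indep: "prob_space.indep_vars M (\<lambda>_. \<Pi>\<^sub>M e\<in>arcs G. lborel) \<epsilon> {1..}"
    and noise_gaussian: "\<forall>k\<ge>1. distributed M (\<Pi>\<^sub>M e\<in>arcs G. lborel) (\<epsilon> k)
        (\<lambda>x. ennreal (gaussian_density_on (arcs G) (\<lambda>_. 0) Cov x))"
    and prior: "\<theta>\<^sub>0 \<in> prob_vectors S" "\<forall>s\<in>S. \<theta>\<^sub>0 s > 0"
  shows "\<exists>(\<theta>bar :: 'a \<Rightarrow> 's \<Rightarrow> real) (wbar :: 'a \<Rightarrow> 'e \<Rightarrow> real).
      (\<forall>s\<in>S. (\<lambda>\<omega>. \<theta>bar \<omega> s) \<in> borel_measurable M) \<and>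
      (\<forall>e\<in>arcs G. (\<lambda>\<omega>. wbar \<omega> e) \<in> borel_measurable M) \<and>
      (\<forall>\<omega>\<in>space M. \<theta>bar \<omega> \<in> prob_vectors S) \<and>
      (\<forall>\<omega>\<in>space M. wbar \<omega> \<in> edge_load R ` strategies R D) \<and>
      (AE \<omega> in M.
         (\<forall>s\<in>S. (\<lambda>k. \<theta> k \<omega> s) \<longlonglongrightarrow> \<theta>bar \<omega> s) \<and>
         (\<forall>e\<in>arcs G. (\<lambda>k. w k \<omega> e) \<longlonglongrightarrow> wbar \<omega> e) \<and>
         (\<forall>s\<in>distinguishable_states (arcs G) S \<l> s\<^sub>0 (wbar \<omega>). \<theta>bar \<omega> s = 0) \<and>
         is_equilibrium_load S R D \<l> (\<theta>bar \<omega>) (wbar \<omega>) \<and>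
         (\<forall>w'. is_equilibrium_load S R D \<l> (\<theta>bar \<omega>) w' \<longrightarrow> w' = wbar \<omega>))"
proof -
  interpret G: fin_digraph G by fact
  interpret L: learning "arcs G" R S \<l> \<alpha> D M s\<^sub>0 Cov \<epsilon> \<theta>\<^sub>0
  proof (intro learning.intro routing_game.intro learning_axioms.intro)
    \<comment> \<open>A finite digraph has finitely many simple paths between two vertices.\<close>
    show "finite R"
      using routes(2) G.apaths_finite[of orig dest] by (rule_tac finite_subset) auto
    show "set r \<subseteq> arcs G" if "r \<in> R" for r
      using routes(2) that by (auto simp: G.apath_def G.awalk_def)
    show "finite S" by fact
  qed (use assms in auto)
  have \<theta>: "\<theta> k \<omega> = L.\<theta> k \<omega>" for k \<omega> by (simp add: assms(1) L.\<theta>_def)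
  \<comment> \<open>Stage \<open>k + 1\<close> uses the belief of index \<open>k\<close>; the shift
    disappears in the limit.\<close>
  have w: "w (Suc k) \<omega> = L.load k \<omega>" for k \<omega>
    by (simp add: assms(2) stage_load_def L.load_def L.\<theta>_def)
  show ?thesis
  proof (intro exI[of _ L.\<theta>_limit] exI[of _ L.load_limit] conjI ballI)
    show "AE \<omega> in M.
         (\<forall>s\<in>S. (\<lambda>k. \<theta> k \<omega> s) \<longlonglongrightarrow> L.\<theta>_limit \<omega> s) \<and>
         (\<forall>e\<in>arcs G. (\<lambda>k. w k \<omega> e) \<longlonglongrightarrow> L.load_limit \<omega> e) \<and>
         (\<forall>s\<in>distinguishable_states (arcs G) S \<l> s\<^sub>0 (L.load_limit \<omega>). L.\<theta>_limit \<omega> s = 0) \<and>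
         is_equilibrium_load S R D \<l> (L.\<theta>_limit \<omega>) (L.load_limit \<omega>) \<and>
         (\<forall>w'. is_equilibrium_load S R D \<l> (L.\<theta>_limit \<omega>) w' \<longrightarrow> w' = L.load_limit \<omega>)"
      using L.AE_limit
    proof eventually_elim
      case (elim \<omega>)
      then have conv: "\<forall>s\<in>S. convergent (\<lambda>k. L.\<theta> k \<omega> s)" by blast
      have eq: "is_equilibrium_load S R D \<l> (L.\<theta>_limit \<omega>) (L.load_limit \<omega>)"
        unfolding L.load_limit_def by (rule L.is_equilibrium_load_equilibrium_load[OF L.\<theta>_limit_weights])
      have "(\<lambda>k. w (Suc k) \<omega> e) \<longlonglongrightarrow> L.load_limit \<omega> e" for e
        unfolding w by (rule L.tendsto_load_limit[OF conv])
      then have "(\<lambda>k. w k \<omega> e) \<longlonglongrightarrow> L.load_limit \<omega> e" for e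
        by (rule LIMSEQ_imp_Suc)
      moreover have "(\<lambda>k. \<theta> k \<omega> s) \<longlonglongrightarrow> L.\<theta>_limit \<omega> s" if "s \<in> S" for s
        using L.tendsto_\<theta>_limit[OF conv that] by (simp add: \<theta>)
      ultimately show ?case
        using elim eq L.equilibrium_load_unique[OF L.\<theta>_limit_weights _ eq] by blast
    qed
  qed (auto simp: L.\<theta>_limit_measurable L.load_limit_measurable L.\<theta>_limit_prob_vectors
      L.load_limit_def[abs_def] L.equilibrium_load_mem[OF L.\<theta>_limit_weights]
      intro: L.load_limit_measurable[unfolded L.load_limit_def])
qed

end
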